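(* Let $S\subseteq\mathbb{R}[\underline X]=\mathbb{R}[X_1,\dots,X_n]$ be a finite set, let $K_S=\{x\in\mathbb{R}^n: f(x)\ge0\ \text{for all } f\in S\}$ be the corresponding basic closed semialgebraic set, and let $d\ge1$ be an integer. (1) If $K_S$ is compact, then the $\|\cdot\|_w$-topology is finer than the $\|\cdot\|_{K_S}$-topology and $$\overline{M_S}^{\,\|\cdot\|_w}=\overline{T_S}^{\,\|\cdot\|_w}=\overline{\sum\mathbb{R}[\underline X]^{2d}}^{\,\|\cdot\|_{K_S}}=\mathrm{Psd}(K_S).$$ (2) The $\|\cdot\|_w$-topology is finer than $\mathcal{T}_{K_S}$ and $$\overline{M_S}^{\,\|\cdot\|_w}=\overline{T_S}^{\,\|\cdot\|_w}=\overline{\sum\mathbb{R}[\underline X]^{2d}}^{\,\mathcal{T}_{K_S}}=\mathrm{Psd}(K_S).$$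
   Context: $\|\cdot\|_w$ is the norm on $\mathbb{R}[\underline X]$ given by $\big\|\sum_{s\in\mathbb{N}^n}f_s\underline X^s\big\|_w=\sum_{s\in\mathbb{N}^n}|f_s|\,w(s)$, where $w(s)=(2\lceil|s|/2\rceil)!$ and $|s|=s_1+\cdots+s_n$ for $s=(s_1,\dots,s_n)$ (with $0\in\mathbb{N}$). $M_S$ is the quadratic module generated by $S$: the smallest $M\subseteq\mathbb{R}[\underline X]$ containing $S$ with $1\in M$, $M+M\subseteq M$ and $\sum\mathbb{R}[\underline X]^2\cdot M\subseteq M$. $T_S$ is the preordering generated by $S$: the smallest $T\subseteq\mathbb{R}[\underline X]$ containing $S$ with $T+T\subseteq T$, $T\cdot T\subseteq T$ and $\sum\mathbb{R}[\underline X]^2\subseteq T$. $\sum\mathbb{R}[\underline X]^{2d}$ is the set of finite sums of $2d$-th powers of polynomials. For compact $K\subseteq\mathbb{R}^n$, $\|f\|_K:=\sup_{x\in K}|f(x)|$. For $K\subseteq\mathbb{R}^n$, $\mathcal{T}_K$ is the topology on $\mathbb{R}[\underline X]$ generated by the seminorms $\rho_x(f)=|f(x)|$, $x\in K$, and $\mathrm{Psd}(K):=\{f\in\mathbb{R}[\underline X]:f(x)\ge0\text{ for all }x\in K\}$. "Finer" is meant in the non-strict sense. Overlines denote closures in the indicated topologies. *)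

theory Defs
  imports "HOL-Analysis.Analysis" "HOL-Library.Poly_Mapping"
begin

text \<open>
  Polynomials in \<open>n = CARD('n)\<close> variables: finitely supported families of real coefficients
  indexed by multi-indices \<open>s :: 'n \<Rightarrow>\<^sub>0 nat\<close>, with the convolution product of
  \<^theory>\<open>HOL-Library.Poly_Mapping\<close>.
\<close>

type_synonym 'n mpol = "('n \<Rightarrow>\<^sub>0 nat) \<Rightarrow>\<^sub>0 real"

definition eval :: "'n::finite mpol \<Rightarrow> real ^ 'n \<Rightarrow> real" where
  "eval f x =
    (\<Sum>s\<in>Poly_Mapping.keys f.
      Poly_Mapping.lookup f s * (\<Prod>i\<in>UNIV. (x $ i) ^ Poly_Mapping.lookup s i))"

definition mdeg :: "('n::finite \<Rightarrow>\<^sub>0 nat) \<Rightarrow> nat" where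
  "mdeg s = (\<Sum>i\<in>UNIV. Poly_Mapping.lookup s i)"

definition weight :: "('n::finite \<Rightarrow>\<^sub>0 nat) \<Rightarrow> real" where
  "weight s = fact (2 * nat \<lceil>real (mdeg s) / 2\<rceil>)"

definition w_norm :: "'n::finite mpol \<Rightarrow> real" where
  "w_norm f = (\<Sum>s\<in>Poly_Mapping.keys f. \<bar>Poly_Mapping.lookup f s\<bar> * weight s)"

text \<open>
  The supremum over the empty set is taken in \<open>[0, \<infinity>)\<close>, hence \<open>0\<close>; the library
  leaves \<open>Sup {}\<close> on the reals unspecified. For unbounded \<open>f\<close> on \<open>K\<close> the value is
  meaningless, so this is to be used for compact \<open>K\<close> only.
\<close>

definition sup_seminorm :: "(real ^ 'n::finite) set \<Rightarrow> 'n mpol \<Rightarrow> real" where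
  "sup_seminorm K f = (if K = {} then 0 else (SUP x\<in>K. \<bar>eval f x\<bar>))"

definition pt_seminorm :: "real ^ 'n::finite \<Rightarrow> 'n mpol \<Rightarrow> real" where
  "pt_seminorm x f = \<bar>eval f x\<bar>"

text \<open>
  The topology generated by a family \<open>P\<close> of seminorms has the open semiballs as a subbase.
  \<open>UNIV\<close> is inserted so that the empty family generates the indiscrete topology on the
  whole polynomial ring, and not a topology with empty carrier.
\<close>

definition seminorm_topology :: "('n::finite mpol \<Rightarrow> real) set \<Rightarrow> 'n mpol topology" where
  "seminorm_topology P =
    topology_generated_by (insert UNIV {{g. p (g - f) < e} | p f e. p \<in> P \<and> 0 < e})"

definition w_topology :: "'n::finite mpol topology" where
  "w_topology = seminorm_topology {w_norm}"

definition sup_topology :: "(real ^ 'n::finite) set \<Rightarrow> 'n mpol topology" where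
  "sup_topology K = seminorm_topology {sup_seminorm K}"

definition pt_topology :: "(real ^ 'n::finite) set \<Rightarrow> 'n mpol topology" where
  "pt_topology K = seminorm_topology (pt_seminorm ` K)"

definition finer_topology :: "'a topology \<Rightarrow> 'a topology \<Rightarrow> bool" where
  "finer_topology T T' \<longleftrightarrow> (\<forall>U. openin T' U \<longrightarrow> openin T U)"

definition sums_of_powers :: "nat \<Rightarrow> 'n::finite mpol set" where
  "sums_of_powers k = {sum_list (map (\<lambda>g. g ^ k) gs) | gs. True}"

definition is_quadratic_module :: "'n::finite mpol set \<Rightarrow> bool" where
  "is_quadratic_module M \<longleftrightarrow>
    1 \<in> M \<and>
    (\<forall>f\<in>M. \<forall>g\<in>M. f + g \<in> M) \<and>
    (\<forall>h\<in>sums_of_powers 2. \<forall>f\<in>M. h * f \<in> M)"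

definition is_preordering :: "'n::finite mpol set \<Rightarrow> bool" where
  "is_preordering T \<longleftrightarrow>
    (\<forall>f\<in>T. \<forall>g\<in>T. f + g \<in> T) \<and>
    (\<forall>f\<in>T. \<forall>g\<in>T. f * g \<in> T) \<and>
    sums_of_powers 2 \<subseteq> T"

definition gen_quadratic_module :: "'n::finite mpol set \<Rightarrow> 'n mpol set" where
  "gen_quadratic_module S = is_quadratic_module hull S"

definition gen_preordering :: "'n::finite mpol set \<Rightarrow> 'n mpol set" where
  "gen_preordering S = is_preordering hull S"

definition nonneg_set :: "'n::finite mpol set \<Rightarrow> (real ^ 'n) set" where
  "nonneg_set S = {x. \<forall>f\<in>S. 0 \<le> eval f x}"

definition Psd :: "(real ^ 'n::finite) set \<Rightarrow> 'n mpol set" where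
  "Psd K = {f. \<forall>x\<in>K. 0 \<le> eval f x}"

end

theory Submission
  imports Defs
begin

text \<open>
  The only hard inclusion is that of \<open>Psd K\<^sub>S\<close> in the closure of \<open>M\<^sub>S\<close>. Write \<open>P = 1 + \<bar>X\<bar>\<^sup>2\<close>, let
  \<open>f \<ge> 0\<close> on \<open>K\<^sub>S\<close>, let \<open>N > deg f\<close> and \<open>\<epsilon> > 0\<close>, and put \<open>F = f + \<epsilon> P\<^sup>N\<close>.

  First, \<open>P\<^bsup>2m\<^esup> F \<in> M\<^sub>S\<close> for some \<open>m\<close>. Dividing by \<open>P\<^sup>N\<close> and passing to the coordinates \<open>1/P\<close> and
  \<open>X\<^sub>i/P\<close> of inverse stereographic projection turns \<open>F\<close> into a polynomial that is positive on the
  compact part of the sphere cut out by \<open>S\<close>. Subtracting suitable multiples of the constraints makes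
  it positive on a cube, and by Bernstein's theorem it is then a combination, with nonnegative
  coefficients, of products of the \<open>t\<^sub>i\<close> and \<open>1 - t\<^sub>i\<close>, which pull back to sums of squares over powers of \<open>P\<close>.

  Secondly, the denominator can be cancelled in the closure, because \<open>1\<close> is approximated by multiples
  of \<open>P\<^sup>m\<close> in every seminorm given by a \<open>\<parallel>\<cdot>\<parallel>\<^sub>w\<close>-continuous functional that is nonnegative on squares.
  Indeed \<open>cosh \<delta> - cos (\<delta> \<bar>X\<bar>)\<close> is a multiple of \<open>P\<close>, and \<open>1 - cos\<^sup>2\<close> is a sum of squares, so
  multiplication by \<open>cos (\<delta> \<bar>X\<bar>) / cosh \<delta>\<close> is a strict contraction that does not change residues modulo
  \<open>P\<close>. The growth \<open>w(s) \<approx> \<bar>s\<bar>!\<close> is just slow enough for the Taylor series of \<open>cos\<^sup>2 (\<delta> \<bar>X\<bar>)\<close> to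
  converge in \<open>\<parallel>\<cdot>\<parallel>\<^sub>w\<close> for small \<open>\<delta>\<close>. All this is carried out modulo sums of squares, without functionals.
\<close>

section \<open>Evaluation and coefficient norms\<close>

abbreviation cst :: "real \<Rightarrow> 'n mpol" where
  "cst c \<equiv> Poly_Mapping.single 0 c"

definition var :: "'n::finite \<Rightarrow> 'n mpol" where
  "var i = Poly_Mapping.single (Poly_Mapping.single i 1) 1"

definition mono_eval :: "real ^ 'n::finite \<Rightarrow> ('n \<Rightarrow>\<^sub>0 nat) \<Rightarrow> real" where
  "mono_eval x s = (\<Prod>i\<in>UNIV. (x $ i) ^ Poly_Mapping.lookup s i)"

lemma mono_eval_add: "mono_eval x (s + t) = mono_eval x s * mono_eval x t"
  by (simp add: mono_eval_def lookup_add power_add prod.distrib)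

lemma mono_eval_0 [simp]: "mono_eval x 0 = 1"
  by (simp add: mono_eval_def)

lemma mpol_sum_monomials:
  "f = (\<Sum>s\<in>Poly_Mapping.keys f. Poly_Mapping.single s (Poly_Mapping.lookup f s))"
proof (rule poly_mapping_eqI)
  fix k
  have "(\<Sum>s\<in>Poly_Mapping.keys f. (Poly_Mapping.lookup f s when s = k))
     = (\<Sum>s\<in>Poly_Mapping.keys f. if s = k then Poly_Mapping.lookup f s else 0)"
    by (intro sum.cong) auto
  also have "\<dots> = Poly_Mapping.lookup f k"
    by (simp add: sum.delta in_keys_iff)
  finally show "Poly_Mapping.lookup f k = Poly_Mapping.lookup
      (\<Sum>s\<in>Poly_Mapping.keys f. Poly_Mapping.single s (Poly_Mapping.lookup f s)) k"
    by (simp add: lookup_sum lookup_single)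
qed

lemma mpol_mult_monomials:
  fixes f g :: "'n::finite mpol"
  shows "f * g = (\<Sum>s\<in>Poly_Mapping.keys f. \<Sum>t\<in>Poly_Mapping.keys g.
     Poly_Mapping.single (s + t) (Poly_Mapping.lookup f s * Poly_Mapping.lookup g t))"
proof -
  have "f * g = (\<Sum>s\<in>Poly_Mapping.keys f. Poly_Mapping.single s (Poly_Mapping.lookup f s))
      * (\<Sum>t\<in>Poly_Mapping.keys g. Poly_Mapping.single t (Poly_Mapping.lookup g t))"
    using mpol_sum_monomials[of f] mpol_sum_monomials[of g] by simp
  also have "\<dots> = (\<Sum>s\<in>Poly_Mapping.keys f. \<Sum>t\<in>Poly_Mapping.keys g.
     Poly_Mapping.single (s + t) (Poly_Mapping.lookup f s * Poly_Mapping.lookup g t))"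
    by (simp add: sum_product mult_single)
  finally show ?thesis .
qed

lemma eval_superset:
  assumes "finite A" "Poly_Mapping.keys f \<subseteq> A"
  shows "eval f x = (\<Sum>s\<in>A. Poly_Mapping.lookup f s * mono_eval x s)"
  unfolding eval_def mono_eval_def
  by (rule sum.mono_neutral_left) (use assms in \<open>auto simp: in_keys_iff\<close>)

lemma eval_0 [simp]: "eval 0 x = 0"
  by (simp add: eval_def)

lemma eval_add [simp]: "eval (f + g) x = eval f x + eval g x"
proof -
  let ?A = "Poly_Mapping.keys f \<union> Poly_Mapping.keys g"
  have "eval (f + g) x = (\<Sum>s\<in>?A. Poly_Mapping.lookup (f + g) s * mono_eval x s)"
    by (rule eval_superset) (auto simp: keys_add)
  moreover have "eval f x = (\<Sum>s\<in>?A. Poly_Mapping.lookup f s * mono_eval x s)"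
    by (rule eval_superset) auto
  moreover have "eval g x = (\<Sum>s\<in>?A. Poly_Mapping.lookup g s * mono_eval x s)"
    by (rule eval_superset) auto
  ultimately show ?thesis by (simp add: lookup_add sum.distrib ring_distribs)
qed

lemma eval_single [simp]: "eval (Poly_Mapping.single s c) x = c * mono_eval x s"
  by (subst eval_superset[of "{s}"]) auto

lemma eval_uminus [simp]: "eval (- f) x = - eval f x"
  using eval_add[of f "- f" x] by simp

lemma eval_diff [simp]: "eval (f - g) x = eval f x - eval g x"
  using eval_add[of f "- g" x] by simp

lemma eval_sum [simp]: "eval (sum F A) x = (\<Sum>a\<in>A. eval (F a) x)"
  by (induction A rule: infinite_finite_induct) auto

lemma eval_mult [simp]: "eval (f * g) x = eval f x * eval g x"
proof -
  have "eval (f * g) x = (\<Sum>s\<in>Poly_Mapping.keys f. \<Sum>t\<in>Poly_Mapping.keys g.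
      Poly_Mapping.lookup f s * Poly_Mapping.lookup g t * mono_eval x (s + t))"
    by (simp add: mpol_mult_monomials[of f g])
  also have "\<dots> = eval f x * eval g x"
    by (simp add: eval_superset[OF finite_keys order_refl] sum_product mono_eval_add mult_ac)
  finally show ?thesis .
qed

lemma eval_1 [simp]: "eval 1 x = 1"
  using eval_single[of 0 1 x] by simp

lemma eval_numeral [simp]: "eval (numeral k) x = numeral k"
  by (metis eval_single single_numeral mono_eval_0 mult_1_right)

lemma eval_power [simp]: "eval (f ^ k) x = eval f x ^ k"
  by (induction k) auto

lemma eval_prod [simp]: "eval (prod F A) x = (\<Prod>a\<in>A. eval (F a) x)"
  by (induction A rule: infinite_finite_induct) auto

lemma eval_sum_list [simp]: "eval (sum_list fs) x = (\<Sum>f\<leftarrow>fs. eval f x)"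
  by (induction fs) auto

lemma eval_var [simp]: "eval (var i) x = x $ i"
proof -
  have "(\<Prod>j\<in>UNIV. (x $ j) ^ Poly_Mapping.lookup (Poly_Mapping.single i (1::nat)) j)
      = (\<Prod>j\<in>UNIV. if j = i then x $ i else 1)"
    by (intro prod.cong) (auto simp: lookup_single when_def)
  then show ?thesis by (simp add: var_def mono_eval_def)
qed

lemma continuous_on_eval [continuous_intros]: "continuous_on A (eval f)"
  unfolding eval_def by (intro continuous_intros)

text \<open>Dedekind's independence of characters, for the monomials as characters of
  the multiplicative monoid \<open>real ^ 'n\<close>.\<close>

lemma mono_eval_independent:
  fixes A :: "('n::finite \<Rightarrow>\<^sub>0 nat) set"
  assumes "finite A" "\<And>x :: real ^ 'n. (\<Sum>s\<in>A. c s * mono_eval x s) = 0"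
  shows "\<forall>s\<in>A. c s = 0"
  using assms
proof (induction A arbitrary: c rule: finite_induct)
  case (insert a A)
  have "c s = 0" if "s \<in> A" for s
  proof -
    from that insert.hyps have "s \<noteq> a" by auto
    then obtain i where i: "Poly_Mapping.lookup s i \<noteq> Poly_Mapping.lookup a i"
      by (metis poly_mapping_eqI)
    \<comment> \<open>This point separates the monomials \<open>s\<close> and \<open>a\<close>: its
      values there are powers of 2 with different exponents.\<close>
    define y :: "real ^ 'n" where "y = (\<chi> j. if j = i then 2 else 1)"
    have y: "mono_eval y r = 2 ^ Poly_Mapping.lookup r i" for r
    proof -
      have "mono_eval y r = (\<Prod>j\<in>UNIV. if j = i then 2 ^ Poly_Mapping.lookup r i else 1)"
        unfolding mono_eval_def y_def by (intro prod.cong) auto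
      then show ?thesis by simp
    qed
    have "(\<Sum>r\<in>A. (c r * (mono_eval y r - mono_eval y a)) * mono_eval x r) = 0" for x
    proof -
      define xy where "xy = (\<chi> j. x $ j * y $ j)"
      have m: "mono_eval xy r = mono_eval x r * mono_eval y r" for r
        by (simp add: mono_eval_def xy_def power_mult_distrib prod.distrib)
      \<comment> \<open>The relation at the coordinatewise product \<open>xy\<close>, minus
        \<open>mono_eval y a\<close> times the relation at \<open>x\<close>, has no term at
        \<open>a\<close>; the induction hypothesis applies to what is left.\<close>
      have "(\<Sum>r\<in>insert a A. c r * mono_eval xy r)
          - mono_eval y a * (\<Sum>r\<in>insert a A. c r * mono_eval x r) = 0"
        unfolding insert.prems by simp
      then have "(\<Sum>r\<in>insert a A. (c r * (mono_eval y r - mono_eval y a)) * mono_eval x r) = 0"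
        by (simp only: m sum_distrib_left sum_subtractf[symmetric]) (simp add: algebra_simps)
      then show ?thesis using insert.hyps by simp
    qed
    from insert.IH[OF this] that have "c s * (mono_eval y s - mono_eval y a) = 0" by blast
    then show ?thesis using i y by simp
  qed
  moreover from this have "c a = 0"
    using insert.prems[of "\<chi> j. 1"] insert.hyps by (simp add: mono_eval_def)
  ultimately show ?case by auto
qed simp

text \<open>Lets polynomial identities be checked pointwise, by real arithmetic.\<close>

lemma eval_inject:
  fixes f g :: "'n::finite mpol"
  assumes "\<And>x. eval f x = eval g x"
  shows "f = g"
proof -
  have "\<forall>s\<in>Poly_Mapping.keys (f - g). Poly_Mapping.lookup (f - g) s = 0"
    by (rule mono_eval_independent)
      (use assms in \<open>simp_all add: eval_superset[OF finite_keys order_refl, symmetric]\<close>)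
  then have "Poly_Mapping.lookup (f - g) s = 0" for s by (metis in_keys_iff)
  then show ?thesis by (intro poly_mapping_eqI) (simp add: lookup_minus)
qed

lemma cst_add: "cst (a + b) = cst a + cst b"
  by (rule single_add)

lemma cst_mult: "cst (a * b) = cst a * (cst b :: 'n::finite mpol)"
  by (simp add: mult_single)

lemma cst_power: "cst (a ^ k) = (cst a :: 'n::finite mpol) ^ k"
  by (induction k) (simp_all add: cst_mult)

section \<open>Weighted l1 norms of coefficient families\<close>

definition l1_norm :: "(('n \<Rightarrow>\<^sub>0 nat) \<Rightarrow> real) \<Rightarrow> 'n mpol \<Rightarrow> real" where
  "l1_norm v f = (\<Sum>s\<in>Poly_Mapping.keys f. \<bar>Poly_Mapping.lookup f s\<bar> * v s)"

lemma l1_norm_superset: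
  assumes "finite A" "Poly_Mapping.keys f \<subseteq> A"
  shows "l1_norm v f = (\<Sum>s\<in>A. \<bar>Poly_Mapping.lookup f s\<bar> * v s)"
  unfolding l1_norm_def
  by (rule sum.mono_neutral_left) (use assms in \<open>auto simp: in_keys_iff\<close>)

lemma w_norm_eq: "w_norm = l1_norm weight"
  by (simp add: fun_eq_iff w_norm_def l1_norm_def)

lemma l1_norm_0 [simp]: "l1_norm v 0 = 0"
  by (simp add: l1_norm_def)

lemma l1_norm_nonneg: "(\<And>s. 0 \<le> v s) \<Longrightarrow> 0 \<le> l1_norm v f"
  unfolding l1_norm_def by (intro sum_nonneg) auto

lemma l1_norm_add:
  assumes "\<And>s. 0 \<le> v s"
  shows "l1_norm v (f + g) \<le> l1_norm v f + l1_norm v g"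
proof -
  let ?A = "Poly_Mapping.keys f \<union> Poly_Mapping.keys g"
  have "l1_norm v (f + g) = (\<Sum>s\<in>?A. \<bar>Poly_Mapping.lookup (f + g) s\<bar> * v s)"
    by (rule l1_norm_superset) (auto simp: keys_add)
  also have "\<dots> \<le> (\<Sum>s\<in>?A. \<bar>Poly_Mapping.lookup f s\<bar> * v s + \<bar>Poly_Mapping.lookup g s\<bar> * v s)"
    unfolding ring_distribs[symmetric]
    by (intro sum_mono mult_right_mono) (auto simp: assms lookup_add)
  also have "\<dots> = l1_norm v f + l1_norm v g"
    by (subst (1 2) l1_norm_superset[of ?A]) (auto simp: sum.distrib)
  finally show ?thesis .
qed

lemma l1_norm_sum:
  assumes "\<And>s. 0 \<le> v s"
  shows "l1_norm v (sum F A) \<le> (\<Sum>a\<in>A. l1_norm v (F a))"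
proof (induction A rule: infinite_finite_induct)
  case (insert a A)
  then show ?case using l1_norm_add[of v "F a" "sum F A"] assms by simp
qed auto

lemma l1_norm_single: "l1_norm v (Poly_Mapping.single s c) = \<bar>c\<bar> * v s"
  by (subst l1_norm_superset[of "{s}"]) auto

text \<open>Meant for the constant weight 1. The weight \<open>weight\<close> is not
  submultiplicative: two monomials of degree 2 have weight 2 each, their product has weight
  24.\<close>

lemma l1_norm_mult:
  fixes f g :: "'n::finite mpol"
  assumes "\<And>s. 0 \<le> v s" "\<And>s t. v (s + t) \<le> v s * v t"
  shows "l1_norm v (f * g) \<le> l1_norm v f * l1_norm v g"
proof -
  have "l1_norm v (f * g) \<le> (\<Sum>s\<in>Poly_Mapping.keys f. \<Sum>t\<in>Poly_Mapping.keys g.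
     l1_norm v (Poly_Mapping.single (s + t) (Poly_Mapping.lookup f s * Poly_Mapping.lookup g t)))"
    unfolding mpol_mult_monomials[of f g]
    by (intro order.trans[OF l1_norm_sum] sum_mono l1_norm_sum assms)
  also have "\<dots> \<le> (\<Sum>s\<in>Poly_Mapping.keys f. \<Sum>t\<in>Poly_Mapping.keys g.
     (\<bar>Poly_Mapping.lookup f s\<bar> * \<bar>Poly_Mapping.lookup g t\<bar>) * (v s * v t))"
    unfolding l1_norm_single abs_mult
    by (intro sum_mono mult_left_mono assms) auto
  also have "\<dots> = l1_norm v f * l1_norm v g"
    by (simp add: l1_norm_def sum_product mult_ac)
  finally show ?thesis .
qed

lemma lookup_cst_times [simp]:
  "Poly_Mapping.lookup (cst c * (f :: 'n::finite mpol)) s = c * Poly_Mapping.lookup f s"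
proof -
  have "Poly_Mapping.lookup (cst c * f) s = Poly_Mapping.lookup (Poly_Mapping.map ((*) c) f) s"
    by (simp add: mult_map_scale_conv_mult)
  then show ?thesis by (simp add: Poly_Mapping.map.rep_eq when_def)
qed

lemma l1_norm_cst_times: "l1_norm v (cst c * (f :: 'n::finite mpol)) = \<bar>c\<bar> * l1_norm v f"
proof -
  have "Poly_Mapping.keys (cst c * f) \<subseteq> Poly_Mapping.keys f"
    by (auto simp: in_keys_iff)
  then show ?thesis
    by (simp add: l1_norm_superset[of "Poly_Mapping.keys f"] sum_distrib_left abs_mult mult.assoc)
qed

lemma mdeg_add: "mdeg (s + t) = mdeg s + mdeg t"
  by (simp add: mdeg_def lookup_add sum.distrib)

lemma fact_mdeg_le_weight: "fact (mdeg s) \<le> weight s"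
  unfolding weight_def by (intro fact_mono) linarith

lemma weight_le_fact_Suc_mdeg: "weight s \<le> fact (Suc (mdeg s))"
  unfolding weight_def by (intro fact_mono) linarith

lemma weight_nonneg: "0 \<le> weight s"
  by (simp add: weight_def)

lemmas w_norm_0 = l1_norm_0[of weight, folded w_norm_eq]
lemmas w_norm_nonneg = l1_norm_nonneg[of weight, OF weight_nonneg, folded w_norm_eq]
lemmas w_norm_add = l1_norm_add[of weight, OF weight_nonneg, folded w_norm_eq]
lemmas w_norm_sum = l1_norm_sum[of weight, OF weight_nonneg, folded w_norm_eq]
lemmas w_norm_cst_times = l1_norm_cst_times[of weight, folded w_norm_eq]

text \<open>Passes to a submultiplicative norm at the price of one factorial of the degree.\<close>

lemma w_norm_le_l1_norm:
  fixes f :: "'n::finite mpol"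
  assumes "\<And>s. s \<in> Poly_Mapping.keys f \<Longrightarrow> mdeg s \<le> D"
  shows "w_norm f \<le> fact (Suc D) * l1_norm (\<lambda>_. 1) f"
proof -
  have "w_norm f \<le> (\<Sum>s\<in>Poly_Mapping.keys f. \<bar>Poly_Mapping.lookup f s\<bar> * fact (Suc D))"
    unfolding w_norm_def
  proof (intro sum_mono mult_left_mono)
    fix s assume "s \<in> Poly_Mapping.keys f"
    then have "fact (Suc (mdeg s)) \<le> (fact (Suc D) :: real)"
      by (intro fact_mono) (use assms in auto)
    then show "weight s \<le> fact (Suc D)" using weight_le_fact_Suc_mdeg[of s] by linarith
  qed auto
  then show ?thesis by (simp add: l1_norm_def sum_distrib_left mult_ac)
qed

lemma power_le_exp_fact:
  assumes "(0::real) \<le> R"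
  shows "R ^ k \<le> exp R * fact k"
proof -
  have "R ^ k /\<^sub>R fact k \<le> suminf (\<lambda>n. R ^ n /\<^sub>R fact n)"
    using sum_le_suminf[OF summable_exp_generic[of R], of "{k}"] assms by simp
  then show ?thesis by (simp add: exp_def field_simps)
qed

lemma abs_mono_eval_le:
  assumes "norm x \<le> R"
  shows "\<bar>mono_eval x s\<bar> \<le> R ^ mdeg s"
proof -
  have "\<bar>mono_eval x s\<bar> = (\<Prod>i\<in>UNIV. \<bar>x $ i\<bar> ^ Poly_Mapping.lookup s i)"
    by (simp add: mono_eval_def abs_prod power_abs)
  also have "\<dots> \<le> (\<Prod>i\<in>UNIV. R ^ Poly_Mapping.lookup s i)"
    by (intro prod_mono conjI power_mono zero_le_power abs_ge_zero)
      (use assms component_le_norm_cart order_trans in blast)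
  finally show ?thesis by (simp add: mdeg_def power_sum)
qed

text \<open>A monomial of degree k is at most \<open>R ^ k\<close> on the ball of radius R, and
  \<open>R ^ k / k!\<close> is a single term of the series of \<open>exp R\<close>. The constant is
  the same on the whole ball, which serves the sup seminorm of a compact set.\<close>

lemma abs_eval_le_w_norm:
  assumes "norm x \<le> R"
  shows "\<bar>eval f x\<bar> \<le> exp R * w_norm f"
proof -
  have R: "0 \<le> R" using assms norm_ge_zero order_trans by blast
  have "\<bar>eval f x\<bar> \<le> (\<Sum>s\<in>Poly_Mapping.keys f. \<bar>Poly_Mapping.lookup f s * mono_eval x s\<bar>)"
    unfolding eval_superset[OF finite_keys order_refl] by (rule sum_abs)
  also have "\<dots> \<le> (\<Sum>s\<in>Poly_Mapping.keys f. \<bar>Poly_Mapping.lookup f s\<bar> * (exp R * weight s))"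
    unfolding abs_mult
  proof (intro sum_mono mult_left_mono abs_ge_zero)
    fix s
    have "\<bar>mono_eval x s\<bar> \<le> exp R * fact (mdeg s)"
      using abs_mono_eval_le[OF assms, of s] power_le_exp_fact[OF R, of "mdeg s"] by linarith
    also have "\<dots> \<le> exp R * weight s" by (simp add: fact_mdeg_le_weight)
    finally show "\<bar>mono_eval x s\<bar> \<le> exp R * weight s" .
  qed
  finally show ?thesis by (simp add: w_norm_def sum_distrib_left mult_ac)
qed

section \<open>Topologies given by seminorms\<close>

lemma topspace_seminorm_topology [simp]: "topspace (seminorm_topology P) = UNIV"
  unfolding seminorm_topology_def by simp

lemma openin_semiball:
  assumes "p \<in> P" "0 < e"
  shows "openin (seminorm_topology P) {g. p (g - f) < e}"
  unfolding seminorm_topology_def using assms by (intro topology_generated_by_Basis) blast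

text \<open>The subbasic semiballs have arbitrary centres. By the triangle inequality, one around
  \<open>f0\<close> that contains \<open>f\<close> also contains a semiball around \<open>f\<close>,
  of radius \<open>e0 - p (f - f0)\<close>.\<close>

lemma seminorm_topology_nbhd:
  fixes P :: "('n::finite mpol \<Rightarrow> real) set"
  assumes sub: "\<And>p f g. p \<in> P \<Longrightarrow> p (f + g) \<le> p f + p g"
    and U: "openin (seminorm_topology P) U" "f \<in> U"
  obtains F e where "finite F" "F \<subseteq> P" "0 < e" "\<And>g. (\<forall>p\<in>F. p (g - f) < e) \<Longrightarrow> g \<in> U"
proof -
  define \<S> where "\<S> = insert UNIV {{g. p (g - f) < e} | p (f :: 'n mpol) (e :: real). p \<in> P \<and> 0 < e}"
  have "generate_topology_on \<S> U"
    using U unfolding seminorm_topology_def \<S>_def by (simp add: openin_topology_generated_by_iff)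
  then have "\<exists>F e. finite F \<and> F \<subseteq> P \<and> 0 < e \<and> (\<forall>g. (\<forall>p\<in>F. p (g - f) < e) \<longrightarrow> g \<in> U)"
    using U(2)
  proof induction
    case Empty
    then show ?case by simp
  next
    case (Int A B)
    then obtain F1 e1 F2 e2 where
      1: "finite F1" "F1 \<subseteq> P" "0 < e1" "\<forall>g. (\<forall>p\<in>F1. p (g - f) < e1) \<longrightarrow> g \<in> A" and
      2: "finite F2" "F2 \<subseteq> P" "0 < e2" "\<forall>g. (\<forall>p\<in>F2. p (g - f) < e2) \<longrightarrow> g \<in> B"
      by auto
    have "\<forall>g. (\<forall>p\<in>F1 \<union> F2. p (g - f) < min e1 e2) \<longrightarrow> g \<in> A \<inter> B" using 1(4) 2(4) by auto
    then show ?case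
      using 1 2 by (intro exI[of _ "F1 \<union> F2"] exI[of _ "min e1 e2"]) auto
  next
    case (UN \<K>)
    then obtain k where k: "k \<in> \<K>" "f \<in> k" by auto
    with UN.IH[OF k] show ?case
      by (elim exE conjE) (intro exI conjI; blast)
  next
    case (Basis A)
    then consider "A = UNIV" | p f0 e0 where "A = {g. p (g - f0) < e0}" "p \<in> P" "0 < e0"
      unfolding \<S>_def by blast
    then show ?case
    proof cases
      case 1
      then show ?thesis by (intro exI[of _ "{}"] exI[of _ 1]) auto
    next
      case 2
      have "g \<in> A" if "p (g - f) < e0 - p (f - f0)" for g
        using sub[OF 2(2), of "g - f" "f - f0"] that by (simp add: 2(1))
      then show ?thesis
        using 2 Basis.prems by (intro exI[of _ "{p}"] exI[of _ "e0 - p (f - f0)"]) auto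
    qed
  qed
  then show thesis using that by blast
qed

lemma in_closure_seminorm_topologyI:
  fixes P :: "('n::finite mpol \<Rightarrow> real) set"
  assumes sub: "\<And>p f g. p \<in> P \<Longrightarrow> p (f + g) \<le> p f + p g"
    and approx: "\<And>F e. finite F \<Longrightarrow> F \<subseteq> P \<Longrightarrow> 0 < e \<Longrightarrow> \<exists>a\<in>A. \<forall>p\<in>F. p (a - f) < e"
  shows "f \<in> seminorm_topology P closure_of A"
  unfolding in_closure_of
proof (intro conjI allI impI)
  fix U assume "f \<in> U \<and> openin (seminorm_topology P) U"
  then have U: "f \<in> U" "openin (seminorm_topology P) U" by auto
  obtain F e where
    F: "finite F" "F \<subseteq> P" "0 < e" "\<And>g. (\<forall>p\<in>F. p (g - f) < e) \<Longrightarrow> g \<in> U"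
    by (rule seminorm_topology_nbhd[OF _ U(2,1)]) (use sub in blast)+
  then show "\<exists>y. y \<in> A \<and> y \<in> U" using approx[of F e] by blast
qed simp

lemma closure_of_openin_witness:
  assumes "f \<in> T closure_of A" "openin T U" "f \<in> U"
  shows "\<exists>y. y \<in> A \<and> y \<in> U"
  using assms by (simp add: in_closure_of)

text \<open>Point evaluations on \<open>K\<close> are continuous, so a negative value of a limit
  would already occur for an element of \<open>A\<close>. Serves all three topologies.\<close>

lemma closure_of_subset_Psd:
  fixes P :: "('n::finite mpol \<Rightarrow> real) set"
  assumes dom: "\<And>x. x \<in> K \<Longrightarrow> \<exists>p\<in>P. \<exists>C>0. p 0 = 0 \<and> (\<forall>g. \<bar>eval g x\<bar> \<le> C * p g)"
    and A: "A \<subseteq> Psd K"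
  shows "seminorm_topology P closure_of A \<subseteq> Psd K"
proof
  fix f assume f: "f \<in> seminorm_topology P closure_of A"
  show "f \<in> Psd K"
    unfolding Psd_def
  proof (intro CollectI ballI, rule ccontr)
    fix x assume x: "x \<in> K" "\<not> 0 \<le> eval f x"
    from dom[OF x(1)] obtain p C where p: "p \<in> P" "0 < C" "p 0 = 0"
      and le: "\<And>g. \<bar>eval g x\<bar> \<le> C * p g" by blast
    define e where "e = - eval f x / C"
    have e: "0 < e" using x p by (simp add: e_def divide_neg_pos)
    have "\<exists>y. y \<in> A \<and> y \<in> {g. p (g - f) < e}"
      by (rule closure_of_openin_witness[OF f openin_semiball[OF p(1) e]]) (use p e in simp)
    then obtain a where a: "a \<in> A" "p (a - f) < e" by auto
    have "C * p (a - f) < C * e" using a(2) p(2) by simp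
    then have "eval a x < 0" using le[of "a - f"] p(2) by (simp add: e_def)
    then show False using a(1) A x(1) by (force simp: Psd_def)
  qed
qed

lemma w_topology_finer:
  fixes P :: "('n::finite mpol \<Rightarrow> real) set"
  assumes sub: "\<And>p f g. p \<in> P \<Longrightarrow> p (f + g) \<le> p f + p g"
    and dom: "\<And>p. p \<in> P \<Longrightarrow> \<exists>C>0. \<forall>g. p g \<le> C * w_norm g"
  shows "finer_topology w_topology (seminorm_topology P)"
  unfolding finer_topology_def
proof (intro allI impI)
  fix U assume U: "openin (seminorm_topology P) U"
  show "openin w_topology U"
  proof (subst openin_subopen, intro ballI)
    fix f assume f: "f \<in> U"
    obtain F e where
      F: "finite F" "F \<subseteq> P" "0 < e" "\<And>g. (\<forall>p\<in>F. p (g - f) < e) \<Longrightarrow> g \<in> U"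
      by (rule seminorm_topology_nbhd[OF _ U f]) (use sub in blast)+
    have "\<forall>p\<in>F. \<exists>C>0. \<forall>g. p g \<le> C * w_norm g" using F(2) dom by blast
    then obtain C where C: "\<And>p. p \<in> F \<Longrightarrow> 0 < C p" "\<And>p g. p \<in> F \<Longrightarrow> p g \<le> C p * w_norm g"
      by metis
    \<comment> \<open>The summand 1 keeps \<open>B\<close> positive when \<open>F\<close> is
      empty.\<close>
    define B where "B = 1 + (\<Sum>p\<in>F. C p)"
    have CB: "C p \<le> B" if "p \<in> F" for p
    proof -
      have "C p \<le> sum C F" using that F(1) C(1) by (intro member_le_sum) (auto simp: less_imp_le)
      then show ?thesis by (simp add: B_def)
    qed
    have "0 \<le> sum C F" using C(1) by (intro sum_nonneg) (auto simp: less_imp_le)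
    then have B: "0 < B" by (simp add: B_def)
    have "{g. w_norm (g - f) < e / B} \<subseteq> U"
    proof
      fix g assume "g \<in> {g. w_norm (g - f) < e / B}"
      then have g: "B * w_norm (g - f) < e" using B by (simp add: field_simps)
      have "p (g - f) < e" if "p \<in> F" for p
        using C(2)[OF that, of "g - f"] mult_right_mono[OF CB[OF that] w_norm_nonneg[of "g - f"]] g
        by linarith
      then show "g \<in> U" using F(4) by blast
    qed
    moreover have "openin w_topology {g. w_norm (g - f) < e / B}"
      unfolding w_topology_def using F(3) B by (intro openin_semiball) auto
    moreover have "f \<in> {g. w_norm (g - f) < e / B}" using F(3) B by (simp add: w_norm_0)
    ultimately show "\<exists>T. openin w_topology T \<and> f \<in> T \<and> T \<subseteq> U" by blast
  qed
qed

lemma in_w_closureI: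
  fixes A :: "'n::finite mpol set"
  assumes "\<And>e. 0 < e \<Longrightarrow> \<exists>a\<in>A. w_norm (a - f) < e"
  shows "f \<in> w_topology closure_of A"
  unfolding w_topology_def
proof (rule in_closure_seminorm_topologyI)
  fix F :: "('n mpol \<Rightarrow> real) set" and e :: real
  assume F: "finite F" "F \<subseteq> {w_norm}" "0 < e"
  then show "\<exists>a\<in>A. \<forall>p\<in>F. p (a - f) < e" using assms[of e] by blast
qed (auto intro: w_norm_add)

lemma in_w_closureD:
  assumes "f \<in> w_topology closure_of A" "0 < e"
  shows "\<exists>a\<in>A. w_norm (a - f) < e"
proof -
  have "openin w_topology {g. w_norm (g - f) < e}"
    unfolding w_topology_def using assms(2) by (intro openin_semiball) auto
  moreover have "f \<in> {g. w_norm (g - f) < e}" using assms(2) by (simp add: w_norm_0)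
  ultimately have "\<exists>y. y \<in> A \<and> y \<in> {g. w_norm (g - f) < e}"
    by (rule closure_of_openin_witness[OF assms(1)])
  then show ?thesis by auto
qed

lemma w_closure_subset_Psd:
  assumes "A \<subseteq> Psd K"
  shows "w_topology closure_of A \<subseteq> Psd K"
  unfolding w_topology_def
proof (rule closure_of_subset_Psd[OF _ assms])
  fix x :: "real ^ 'a"
  show "\<exists>p\<in>{w_norm}. \<exists>C>0. p 0 = 0 \<and> (\<forall>g. \<bar>eval g x\<bar> \<le> C * p g)"
    using abs_eval_le_w_norm[of x "norm x"] by (auto simp: w_norm_0 intro!: exI[of _ "exp (norm x)"])
qed

section \<open>The seminorms attached to a set of points\<close>

lemma pt_seminorm_add: "pt_seminorm x (f + g) \<le> pt_seminorm x f + pt_seminorm x g"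
  by (simp add: pt_seminorm_def)

lemma pt_seminorm_le_w_norm: "pt_seminorm x f \<le> exp (norm x) * w_norm f"
  unfolding pt_seminorm_def by (rule abs_eval_le_w_norm) simp

lemma bdd_above_abs_eval:
  assumes "compact K"
  shows "bdd_above ((\<lambda>x. \<bar>eval f x\<bar>) ` K)"
  by (intro bounded_imp_bdd_above compact_imp_bounded compact_continuous_image assms
      continuous_on_rabs continuous_on_eval)

lemma abs_eval_le_sup_seminorm:
  assumes "compact K" "x \<in> K"
  shows "\<bar>eval f x\<bar> \<le> sup_seminorm K f"
proof -
  have "\<bar>eval f x\<bar> \<le> (SUP x\<in>K. \<bar>eval f x\<bar>)"
    using bdd_above_abs_eval[OF assms(1)] assms(2) by (intro cSUP_upper)
  then show ?thesis using assms(2) by (auto simp: sup_seminorm_def)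
qed

text \<open>The bound \<open>0 \<le> c\<close> covers the empty set, whose seminorm is 0.\<close>

lemma sup_seminorm_le:
  assumes "0 \<le> c" "\<And>x. x \<in> K \<Longrightarrow> \<bar>eval f x\<bar> \<le> c"
  shows "sup_seminorm K f \<le> c"
  using assms by (auto simp: sup_seminorm_def intro: cSUP_least)

lemma sup_seminorm_nonneg:
  assumes "compact K"
  shows "0 \<le> sup_seminorm K f"
proof (cases "K = {}")
  case False
  then obtain x where "x \<in> K" by blast
  then show ?thesis using abs_eval_le_sup_seminorm[OF assms, of x f] by linarith
qed (simp add: sup_seminorm_def)

lemma sup_seminorm_add:
  assumes "compact K"
  shows "sup_seminorm K (f + g) \<le> sup_seminorm K f + sup_seminorm K g"
proof (rule sup_seminorm_le)
  fix x assume "x \<in> K"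
  then show "\<bar>eval (f + g) x\<bar> \<le> sup_seminorm K f + sup_seminorm K g"
    using abs_eval_le_sup_seminorm[OF assms, of x f] abs_eval_le_sup_seminorm[OF assms, of x g]
    by simp
qed (simp add: sup_seminorm_nonneg assms)

lemma sup_seminorm_0 [simp]: "sup_seminorm K 0 = 0"
  by (auto simp: sup_seminorm_def)

lemma w_topology_finer_sup:
  assumes "compact K"
  shows "finer_topology w_topology (sup_topology K)"
  unfolding sup_topology_def
proof (rule w_topology_finer)
  obtain R where R: "\<And>x. x \<in> K \<Longrightarrow> norm x \<le> R"
    using compact_imp_bounded[OF assms] unfolding bounded_iff by blast
  have "sup_seminorm K g \<le> exp R * w_norm g" for g
    by (intro sup_seminorm_le abs_eval_le_w_norm R mult_nonneg_nonneg w_norm_nonneg) auto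
  then show "\<And>p. p \<in> {sup_seminorm K} \<Longrightarrow> \<exists>C>0. \<forall>g. p g \<le> C * w_norm g"
    by (auto intro!: exI[of _ "exp R"])
qed (auto intro: sup_seminorm_add[OF assms])

lemma w_topology_finer_pt: "finer_topology w_topology (pt_topology K)"
  unfolding pt_topology_def
proof (rule w_topology_finer)
  fix p assume "p \<in> pt_seminorm ` K"
  then obtain x where "p = pt_seminorm x" by blast
  then show "\<exists>C>0. \<forall>g. p g \<le> C * w_norm g"
    using pt_seminorm_le_w_norm[of x] by (intro exI[of _ "exp (norm x)"]) auto
qed (auto intro: pt_seminorm_add)

section \<open>Closures of the sums of even powers\<close>

lemma sums_of_even_powers_subset_Psd: "sums_of_powers (2 * d) \<subseteq> Psd K"
proof
  fix f :: "'a mpol" assume "f \<in> sums_of_powers (2 * d)"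
  then obtain gs where f: "f = sum_list (map (\<lambda>g. g ^ (2 * d)) gs)"
    by (auto simp: sums_of_powers_def)
  have "0 \<le> eval f x" for x
    unfolding f eval_sum_list by (intro sum_list_nonneg) (auto simp: power_mult)
  then show "f \<in> Psd K" by (simp add: Psd_def)
qed

lemma power_in_sums_of_powers: "g ^ k \<in> sums_of_powers k"
  unfolding sums_of_powers_def by (intro CollectI exI[of _ "[g]"]) simp

text \<open>Translates the polynomial functions of the Stone-Weierstrass theorem into elements of
  the polynomial ring.\<close>

lemma real_polynomial_function_eval:
  fixes p :: "real ^ 'n::finite \<Rightarrow> real"
  assumes "real_polynomial_function p"
  obtains f :: "'n mpol" where "p = eval f"
proof -
  have "\<exists>f :: 'n mpol. p = eval f"
    using assms
  proof induction
    case (linear h)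
    then interpret bounded_linear h .
    have "h x = eval (\<Sum>i\<in>UNIV. cst (h (axis i 1)) * var i) x" for x
    proof -
      have "h x = h (\<Sum>i\<in>UNIV. (x $ i) *\<^sub>R axis i 1)"
        by (subst basis_expansion[of x, symmetric]) (simp add: scalar_mult_eq_scaleR)
      then show ?thesis by (simp add: sum scaleR mult.commute)
    qed
    then show ?case by blast
  next
    case (const c)
    then show ?case by (intro exI[of _ "cst c"]) (simp add: fun_eq_iff)
  next
    case (add f g)
    then obtain f' g' :: "'n mpol" where "f = eval f'" "g = eval g'" by blast
    then show ?case by (intro exI[of _ "f' + g'"]) (simp add: fun_eq_iff)
  next
    case (mult f g)
    then obtain f' g' :: "'n mpol" where "f = eval f'" "g = eval g'" by blast
    then show ?case by (intro exI[of _ "f' * g'"]) (simp add: fun_eq_iff)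
  qed
  then show thesis using that by blast
qed

text \<open>Approximate the continuous function \<open>f\<^bsup>1/k\<^esup>\<close> on \<open>K\<close> by a polynomial.\<close>

lemma psd_power_approx:
  fixes K :: "(real ^ 'n::finite) set"
  assumes K: "compact K" and f: "f \<in> Psd K" and "1 \<le> k" "0 < e"
  obtains g :: "'n mpol" where "\<And>x. x \<in> K \<Longrightarrow> \<bar>eval (g ^ k - f) x\<bar> < e"
proof -
  define h where "h x = root k (eval f x)" for x
  have h: "continuous_on K h" unfolding h_def by (intro continuous_intros)
  have hk: "h x ^ k = eval f x" if "x \<in> K" for x
    using f that assms(3) by (simp add: h_def Psd_def)
  obtain B where B: "\<And>x. x \<in> K \<Longrightarrow> \<bar>h x\<bar> \<le> B"
    using compact_imp_bounded[OF compact_continuous_image[OF h K]] unfolding bounded_iff by auto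
  \<comment> \<open>The radius exceeds the bound of \<open>h\<close> by 1, so that an approximation
    of \<open>h\<close> within 1 stays in the ball.\<close>
  have "uniformly_continuous_on (cball 0 (\<bar>B\<bar> + 1)) (\<lambda>y :: real. y ^ k)"
    by (intro compact_uniformly_continuous continuous_intros) auto
  then have "\<exists>\<delta>>0. \<forall>y\<in>cball (0 :: real) (\<bar>B\<bar> + 1). \<forall>y'\<in>cball 0 (\<bar>B\<bar> + 1).
      dist y' y < \<delta> \<longrightarrow> dist (y' ^ k) (y ^ k) < e"
    using \<open>0 < e\<close> unfolding uniformly_continuous_on_def by (elim allE[of _ e]) blast
  then obtain \<delta> where \<delta>: "0 < \<delta>"
    "\<And>y y'. y \<in> cball (0 :: real)  (\<bar>B\<bar> + 1) \<Longrightarrow> y' \<in> cball 0 (\<bar>B\<bar> + 1) \<Longrightarrow> dist y' y < \<delta>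
      \<Longrightarrow> dist (y' ^ k) (y ^ k) < e"
    by metis
  obtain p where p: "real_polynomial_function p" "\<And>x. x \<in> K \<Longrightarrow> \<bar>h x - p x\<bar> < min \<delta> 1"
    using Stone_Weierstrass_real_polynomial_function[OF K h, of "min \<delta> 1"] \<delta>(1) by auto
  obtain g where g: "p = eval g" using real_polynomial_function_eval[OF p(1)] .
  have "\<bar>eval (g ^ k - f) x\<bar> < e" if x: "x \<in> K" for x
  proof -
    have "dist (p x ^ k) (h x ^ k) < e"
      using p(2)[OF x] B[OF x] by (intro \<delta>(2)) (auto simp: dist_real_def)
    then show ?thesis using hk[OF x] by (simp add: g dist_real_def)
  qed
  then show thesis using that by blast
qed

lemma sup_closure_sums_of_even_powers:
  fixes K :: "(real ^ 'n::finite) set"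
  assumes K: "compact K" and d: "1 \<le> d"
  shows "sup_topology K closure_of sums_of_powers (2 * d) = Psd K"
proof
  show "sup_topology K closure_of sums_of_powers (2 * d) \<subseteq> Psd K"
    unfolding sup_topology_def
    by (intro closure_of_subset_Psd sums_of_even_powers_subset_Psd)
      (auto intro!: exI[of _ 1] abs_eval_le_sup_seminorm K)
  show "Psd K \<subseteq> sup_topology K closure_of sums_of_powers (2 * d)"
    unfolding sup_topology_def
  proof
    fix f assume f: "f \<in> Psd K"
    show "f \<in> seminorm_topology {sup_seminorm K} closure_of sums_of_powers (2 * d)"
    proof (rule in_closure_seminorm_topologyI)
      fix F :: "('n mpol \<Rightarrow> real) set" and e :: real
      assume F: "F \<subseteq> {sup_seminorm K}" and "0 < e"
      \<comment> \<open>Half of \<open>e\<close>, because a supremum of values below a bound may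
        equal that bound.\<close>
      then obtain g where g: "\<And>x. x \<in> K \<Longrightarrow> \<bar>eval (g ^ (2 * d) - f) x\<bar> < e / 2"
        using psd_power_approx[OF K f, of "2 * d" "e / 2"] d by auto
      have "sup_seminorm K (g ^ (2 * d) - f) \<le> e / 2"
        using \<open>0 < e\<close> g by (intro sup_seminorm_le) (auto intro: less_imp_le)
      then have "\<forall>p\<in>F. p (g ^ (2 * d) - f) < e" using F \<open>0 < e\<close> by auto
      then show "\<exists>a\<in>sums_of_powers (2 * d). \<forall>p\<in>F. p (a - f) < e"
        using power_in_sums_of_powers by blast
    qed (auto intro: sup_seminorm_add[OF K])
  qed
qed

text \<open>A basic neighbourhood involves finitely many points of \<open>K\<close>. These form a
  compact set, so the uniform approximation applies although \<open>K\<close> is arbitrary.\<close>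

lemma pt_closure_sums_of_even_powers:
  fixes K :: "(real ^ 'n::finite) set"
  assumes d: "1 \<le> d"
  shows "pt_topology K closure_of sums_of_powers (2 * d) = Psd K"
proof
  show "pt_topology K closure_of sums_of_powers (2 * d) \<subseteq> Psd K"
    unfolding pt_topology_def
    by (intro closure_of_subset_Psd sums_of_even_powers_subset_Psd)
      (auto intro!: exI[of _ 1] simp: pt_seminorm_def)
  show "Psd K \<subseteq> pt_topology K closure_of sums_of_powers (2 * d)"
    unfolding pt_topology_def
  proof
    fix f assume f: "f \<in> Psd K"
    show "f \<in> seminorm_topology (pt_seminorm ` K) closure_of sums_of_powers (2 * d)"
    proof (rule in_closure_seminorm_topologyI)
      fix F :: "('n mpol \<Rightarrow> real) set" and e :: real
      assume F: "finite F" "F \<subseteq> pt_seminorm ` K" and "0 < e"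
      then obtain K' where K': "K' \<subseteq> K" "finite K'" "F = pt_seminorm ` K'"
        using finite_subset_image by metis
      have "f \<in> Psd K'" using f K'(1) by (auto simp: Psd_def)
      then obtain g where g: "\<And>x. x \<in> K' \<Longrightarrow> \<bar>eval (g ^ (2 * d) - f) x\<bar> < e"
        using psd_power_approx[OF finite_imp_compact[OF K'(2)], of f "2 * d" e] d \<open>0 < e\<close> by auto
      then show "\<exists>a\<in>sums_of_powers (2 * d). \<forall>p\<in>F. p (a - f) < e"
        using power_in_sums_of_powers[of g "2 * d"]
        by (intro bexI[of _ "g ^ (2 * d)"]) (auto simp: K'(3) pt_seminorm_def)
    qed (auto intro: pt_seminorm_add)
  qed
qed

section \<open>Sums of squares and quadratic modules\<close>

abbreviation sos :: "'n::finite mpol set" where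
  "sos \<equiv> sums_of_powers 2"

lemma sos_0 [simp, intro]: "0 \<in> sos"
  unfolding sums_of_powers_def by (intro CollectI exI[of _ "[]"]) simp

lemma sos_square [simp, intro]: "g ^ 2 \<in> sos"
  by (rule power_in_sums_of_powers)

lemma sos_mult_self [simp, intro]: "g * g \<in> sos"
  using sos_square[of g] by (simp add: power2_eq_square)

lemma sos_1 [simp, intro]: "1 \<in> sos"
  using sos_mult_self[of 1] by simp

lemma sos_add [intro]:
  assumes "f \<in> sos" "g \<in> sos"
  shows "f + g \<in> sos"
proof -
  obtain fs gs where "f = sum_list (map (\<lambda>g. g ^ 2) fs)" "g = sum_list (map (\<lambda>g. g ^ 2) gs)"
    using assms by (auto simp: sums_of_powers_def)
  then have "f + g = sum_list (map (\<lambda>g. g ^ 2) (fs @ gs))" by simp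
  then show ?thesis unfolding sums_of_powers_def by blast
qed

lemma sos_induct [consumes 1, case_names zero add]:
  assumes "f \<in> sos" "Q 0" "\<And>g f. f \<in> sos \<Longrightarrow> Q f \<Longrightarrow> Q (g ^ 2 + f)"
  shows "Q f"
proof -
  obtain fs where f: "f = sum_list (map (\<lambda>g. g ^ 2) fs)"
    using assms by (auto simp: sums_of_powers_def)
  have "Q (sum_list (map (\<lambda>g. g ^ 2) fs)) \<and> sum_list (map (\<lambda>g. g ^ 2) fs) \<in> sos"
    by (induction fs) (auto intro: assms)
  then show ?thesis by (simp add: f)
qed

lemma sos_square_mult:
  assumes "f \<in> sos"
  shows "h ^ 2 * f \<in> sos"
  using assms
proof (induction rule: sos_induct)
  case (add g f)
  have "h ^ 2 * (g ^ 2 + f) = (h * g) ^ 2 + h ^ 2 * f"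
    by (simp add: power_mult_distrib distrib_left)
  then show ?case using add.IH by auto
qed simp

lemma sos_mult [intro]:
  assumes "f \<in> sos" "g \<in> sos"
  shows "f * g \<in> sos"
  using assms(1)
proof (induction rule: sos_induct)
  case (add h f)
  then show ?case using sos_square_mult[OF assms(2), of h] by (auto simp: distrib_right)
qed simp

lemma sos_sum [intro]: "(\<And>a. a \<in> A \<Longrightarrow> F a \<in> sos) \<Longrightarrow> sum F A \<in> sos"
  by (induction A rule: infinite_finite_induct) auto

lemma sos_power [intro]: "f \<in> sos \<Longrightarrow> f ^ k \<in> sos"
  by (induction k) auto

lemma sos_cst [intro]:
  assumes "0 \<le> c"
  shows "cst c \<in> (sos :: 'n::finite mpol set)"
proof -
  have "cst c = (cst (sqrt c) * cst (sqrt c) :: 'n mpol)"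
    using assms by (simp add: cst_mult[symmetric])
  then show ?thesis by (metis sos_mult_self)
qed

lemma sos_cst_mult [intro]: "0 \<le> c \<Longrightarrow> f \<in> sos \<Longrightarrow> cst c * f \<in> sos"
  by auto

text \<open>Allows the closure rules of \<open>rational_in\<close> to be used for \<open>sos\<close>
  as well as for the module generated by \<open>S\<close>.\<close>

lemma is_quadratic_module_sos: "is_quadratic_module sos"
  by (auto simp: is_quadratic_module_def)

lemma quadratic_module_add: "is_quadratic_module M \<Longrightarrow> f \<in> M \<Longrightarrow> g \<in> M \<Longrightarrow> f + g \<in> M"
  by (simp add: is_quadratic_module_def)

lemma quadratic_module_mult: "is_quadratic_module M \<Longrightarrow> h \<in> sos \<Longrightarrow> f \<in> M \<Longrightarrow> h * f \<in> M"
  by (simp add: is_quadratic_module_def)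

lemma sos_subset_quadratic_module:
  assumes "is_quadratic_module M"
  shows "sos \<subseteq> M"
proof
  fix f :: "'a mpol" assume "f \<in> sos"
  then have "f * 1 \<in> M" using assms unfolding is_quadratic_module_def by blast
  then show "f \<in> M" by simp
qed

lemma is_preordering_Psd: "is_preordering (Psd K)"
proof -
  have "sos \<subseteq> Psd K" using sums_of_even_powers_subset_Psd[of 1 K] by simp
  then show ?thesis by (auto simp: is_preordering_def Psd_def)
qed

lemma is_quadratic_module_gen: "is_quadratic_module (gen_quadratic_module S)"
  unfolding gen_quadratic_module_def by (rule hull_in) (auto simp: is_quadratic_module_def)

lemma gen_quadratic_module_inc: "f \<in> S \<Longrightarrow> f \<in> gen_quadratic_module S"
  unfolding gen_quadratic_module_def by (rule hull_inc)

lemma gen_quadratic_module_subset_preordering: "gen_quadratic_module S \<subseteq> gen_preordering S"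
proof -
  have "is_quadratic_module T" if "is_preordering T" for T :: "'a mpol set"
    using that by (auto simp: is_preordering_def is_quadratic_module_def)
  then show ?thesis
    unfolding gen_quadratic_module_def gen_preordering_def by (intro hull_antimono) blast
qed

lemma gen_preordering_subset_Psd: "gen_preordering S \<subseteq> Psd (nonneg_set S)"
  unfolding gen_preordering_def
  by (intro hull_minimal is_preordering_Psd) (auto simp: Psd_def nonneg_set_def)

section \<open>Truncated cosines\<close>

lemma cst_sum: "cst (sum f A) = (\<Sum>a\<in>A. cst (f a))"
  by (induction A rule: infinite_finite_induct) (simp_all add: single_add)

definition sq_norm_poly :: "'n::finite mpol" where
  "sq_norm_poly = (\<Sum>i\<in>UNIV. var i ^ 2)"

lemma sq_norm_poly_sos [simp, intro]: "sq_norm_poly \<in> sos"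
  unfolding sq_norm_poly_def by auto

lemma mdeg_var: "s \<in> Poly_Mapping.keys (var i) \<Longrightarrow> mdeg s = 1"
proof -
  assume "s \<in> Poly_Mapping.keys (var i)"
  then have s: "s = Poly_Mapping.single i 1" by (simp add: var_def)
  have "mdeg s = (\<Sum>j\<in>UNIV. if j = i then 1 else 0)"
    unfolding mdeg_def s by (intro sum.cong) (auto simp: lookup_single when_def)
  then show ?thesis by simp
qed

lemma keys_mult_mdeg_le:
  fixes f g :: "'n::finite mpol"
  assumes "\<And>s. s \<in> Poly_Mapping.keys f \<Longrightarrow> mdeg s \<le> a" "\<And>s. s \<in> Poly_Mapping.keys g \<Longrightarrow> mdeg s \<le> b"
    and "s \<in> Poly_Mapping.keys (f * g)"
  shows "mdeg s \<le> a + b"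
  using assms(3) keys_mult[of f g] by (auto simp: mdeg_add intro!: add_mono assms(1,2))

lemma mdeg_sq_norm_poly:
  assumes "s \<in> Poly_Mapping.keys sq_norm_poly"
  shows "mdeg s \<le> 2"
proof -
  have "s \<in> (\<Union>i\<in>UNIV. Poly_Mapping.keys (var i ^ 2))"
    using assms unfolding sq_norm_poly_def by (metis (no_types) Poly_Mapping.keys_sum subsetD)
  then obtain i where "s \<in> Poly_Mapping.keys (var i * var i)" by (auto simp: power2_eq_square)
  then have "mdeg s \<le> 1 + 1" by (rule keys_mult_mdeg_le[rotated 2]) (simp_all add: mdeg_var)
  then show ?thesis by simp
qed

lemma mdeg_sq_norm_poly_power:
  "s \<in> Poly_Mapping.keys (sq_norm_poly ^ j) \<Longrightarrow> mdeg s \<le> 2 * j"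
proof (induction j arbitrary: s)
  case 0
  then show ?case by (simp add: mdeg_def)
next
  case (Suc j)
  then have "s \<in> Poly_Mapping.keys (sq_norm_poly * sq_norm_poly ^ j)" by simp
  then have "mdeg s \<le> 2 + 2 * j"
    by (rule keys_mult_mdeg_le[rotated 2]) (simp_all add: mdeg_sq_norm_poly Suc.IH)
  then show ?case by simp
qed

lemma l1_norm_sq_norm_poly_power:
  "l1_norm (\<lambda>_. 1) (sq_norm_poly ^ j :: 'n::finite mpol) \<le> real CARD('n) ^ j"
proof (induction j)
  case 0
  have "l1_norm (\<lambda>_. 1) (Poly_Mapping.single 0 1 :: 'n mpol) = 1" unfolding l1_norm_single by simp
  then show ?case by simp
next
  case (Suc j)
  have "l1_norm (\<lambda>_. 1) (var i ^ 2 :: 'n mpol) \<le> 1" for i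
    using l1_norm_mult[of "\<lambda>_. 1" "var i" "var i :: 'n mpol"]
    by (simp add: power2_eq_square var_def l1_norm_single)
  then have "l1_norm (\<lambda>_. 1) (sq_norm_poly :: 'n mpol) \<le> (\<Sum>i\<in>(UNIV :: 'n set). 1)"
    unfolding sq_norm_poly_def by (intro order.trans[OF l1_norm_sum] sum_mono) auto
  then have *: "l1_norm (\<lambda>_. 1) (sq_norm_poly :: 'n mpol) \<le> real CARD('n)" by simp
  have "l1_norm (\<lambda>_. 1) (sq_norm_poly ^ Suc j :: 'n mpol)
      \<le> l1_norm (\<lambda>_. 1) (sq_norm_poly :: 'n mpol) * l1_norm (\<lambda>_. 1) (sq_norm_poly ^ j :: 'n mpol)"
    using l1_norm_mult[of "\<lambda>_. 1" "sq_norm_poly" "sq_norm_poly ^ j :: 'n mpol"] by simp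
  also have "\<dots> \<le> real CARD('n) * real CARD('n) ^ j"
    by (intro mult_mono * Suc.IH l1_norm_nonneg) auto
  finally show ?case by simp
qed

lemma fact_add_le: "fact (a + b) \<le> (2 ^ (a + b) * fact a * fact b :: real)"
proof -
  have "(a + b) choose a \<le> 2 ^ (a + b)" by (rule binomial_le_pow2)
  then have "real ((a + b) choose a) \<le> 2 ^ (a + b)" by (metis of_nat_le_iff of_nat_numeral of_nat_power)
  moreover have "real ((a + b) choose a) = fact (a + b) / (fact a * fact b)"
    by (subst binomial_fact) simp_all
  ultimately show ?thesis by (simp add: field_simps)
qed

text \<open>The point is that \<open>C\<close> does not depend on \<open>j\<close>:
  \<open>fact_add_le\<close> splits off the factorial caused by the degree of \<open>H\<close>,
  leaving only \<open>(2j)!\<close> and the geometric factor \<open>4 ^ j\<close>.\<close>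

lemma w_norm_mult_sq_norm_poly_power:
  fixes H :: "'n::finite mpol"
  obtains C where "0 \<le> C" "\<And>j. w_norm (H * sq_norm_poly ^ j) \<le> C * (4 * real CARD('n)) ^ j * fact (2 * j)"
proof -
  define D where "D = Max (insert 0 (mdeg ` Poly_Mapping.keys H))"
  have D: "mdeg s \<le> D" if "s \<in> Poly_Mapping.keys H" for s
    unfolding D_def using that by (intro Max_ge) auto
  define L where "L = l1_norm (\<lambda>_. 1) H"
  have L: "0 \<le> L" unfolding L_def by (rule l1_norm_nonneg) simp
  have "w_norm (H * sq_norm_poly ^ j)
      \<le> (2 ^ Suc D * fact (Suc D) * L) * (4 * real CARD('n)) ^ j * fact (2 * j)" for j
  proof -
    have "w_norm (H * sq_norm_poly ^ j) \<le> fact (Suc (D + 2 * j)) * l1_norm (\<lambda>_. 1) (H * sq_norm_poly ^ j)"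
      by (rule w_norm_le_l1_norm, rule keys_mult_mdeg_le[OF D mdeg_sq_norm_poly_power])
    also have "\<dots> \<le> (2 ^ (Suc D + 2 * j) * fact (Suc D) * fact (2 * j)) * (L * real CARD('n) ^ j)"
    proof (rule mult_mono)
      show "fact (Suc (D + 2 * j)) \<le> (2 ^ (Suc D + 2 * j) * fact (Suc D) * fact (2 * j) :: real)"
        using fact_add_le[of "Suc D" "2 * j"] by simp
      have "l1_norm (\<lambda>_. 1) (H * sq_norm_poly ^ j) \<le> L * l1_norm (\<lambda>_. 1) (sq_norm_poly ^ j :: 'n mpol)"
        unfolding L_def by (rule l1_norm_mult) auto
      also have "\<dots> \<le> L * real CARD('n) ^ j"
        by (intro mult_left_mono l1_norm_sq_norm_poly_power L)
      finally show "l1_norm (\<lambda>_. 1) (H * sq_norm_poly ^ j) \<le> L * real CARD('n) ^ j" .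
    qed (auto intro: l1_norm_nonneg)
    also have "\<dots> = (2 ^ Suc D * fact (Suc D) * L) * (4 * real CARD('n)) ^ j * fact (2 * j)"
      by (simp add: power_add power_mult power_mult_distrib)
    finally show ?thesis .
  qed
  moreover have "0 \<le> 2 ^ Suc D * fact (Suc D) * L" using L by simp
  ultimately show thesis using that by blast
qed

section \<open>The Pythagorean identity for truncated cosine and sine\<close>

lemma sum_even_odd_split:
  "(\<Sum>i\<le>2 * m. g i) = (\<Sum>i\<le>m. g (2 * i)) + (\<Sum>i<m. g (2 * i + 1))" for g :: "nat \<Rightarrow> real"
  by (induction m) (simp_all add: algebra_simps)

text \<open>The alternating sum of the binomial coefficients \<open>2m choose i\<close> vanishes;
  divide its even and odd parts by \<open>(2m)!\<close>.\<close>

lemma sum_inverse_fact_even_odd: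
  assumes "0 < m"
  shows "(\<Sum>i\<le>m. 1 / (fact (2 * i) * fact (2 * (m - i))))
      = (\<Sum>i<m. 1 / (fact (2 * i + 1) * fact (2 * (m - 1 - i) + 1)) :: real)"
proof -
  have "(\<Sum>i\<le>2 * m. (- 1) ^ i * real (2 * m choose i)) = 0"
    using choose_alternating_sum[of "2 * m", where 'a = real] assms by simp
  then have "(\<Sum>i\<le>m. real (2 * m choose (2 * i))) = (\<Sum>i<m. real (2 * m choose (2 * i + 1)))"
    unfolding sum_even_odd_split by (simp add: sum_negf)
  moreover have "real (2 * m choose (2 * i)) = fact (2 * m) * (1 / (fact (2 * i) * fact (2 * (m - i))))"
    if "i \<le> m" for i
    using that by (subst binomial_fact) (auto simp: diff_mult_distrib2)
  moreover have "real (2 * m choose (2 * i + 1))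
      = fact (2 * m) * (1 / (fact (2 * i + 1) * fact (2 * (m - 1 - i) + 1)))" if "i < m" for i
  proof -
    have "2 * m - (2 * i + 1) = 2 * (m - 1 - i) + 1" using that by linarith
    then show ?thesis using that by (subst binomial_fact) auto
  qed
  ultimately have "fact (2 * m) * (\<Sum>i\<le>m. 1 / (fact (2 * i) * fact (2 * (m - i))))
      = fact (2 * m) * (\<Sum>i<m. 1 / (fact (2 * i + 1) * fact (2 * (m - 1 - i) + 1)) :: real)"
    by (simp add: sum_distrib_left)
  then show ?thesis by simp
qed

text \<open>With \<open>D = \<delta>\<^sup>2\<close> and \<open>z = \<bar>X\<bar>\<^sup>2\<close>, these are the Taylor polynomials
  of \<open>cos (\<delta> \<surd>z)\<close> and of \<open>sin (\<delta> \<surd>z) / (\<delta> \<surd>z)\<close>.\<close>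

definition cos_coeff' :: "real \<Rightarrow> nat \<Rightarrow> real" where
  "cos_coeff' D a = (- D) ^ a / fact (2 * a)"

definition sinc_coeff :: "real \<Rightarrow> nat \<Rightarrow> real" where
  "sinc_coeff D a = (- D) ^ a / fact (2 * a + 1)"

definition cos_poly :: "real \<Rightarrow> nat \<Rightarrow> 'n::finite mpol" where
  "cos_poly D N = (\<Sum>a\<le>N. cst (cos_coeff' D a) * sq_norm_poly ^ a)"

definition sinc_poly :: "real \<Rightarrow> nat \<Rightarrow> 'n::finite mpol" where
  "sinc_poly D N = (\<Sum>a<N. cst (sinc_coeff D a) * sq_norm_poly ^ a)"

text \<open>The summand with \<open>sinc_poly\<close> is the truncation of
  \<open>sin\<^sup>2\<close>. For \<open>0 \<le> D\<close> it is a sum of squares, so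
  \<open>1 - cos_poly\<^sup>2\<close> is one up to this error.\<close>

definition cos_error :: "real \<Rightarrow> nat \<Rightarrow> 'n::finite mpol" where
  "cos_error D N = cos_poly D N ^ 2 + cst D * sq_norm_poly * sinc_poly D N ^ 2 - 1"

text \<open>The coefficient of \<open>z ^ m\<close> in \<open>cos\<^sup>2 + sin\<^sup>2\<close>. The
  factor \<open>D z\<close> of the sine part shifts its index by one, and the signs of the two parts
  are opposite.\<close>

lemma cos_sinc_coeff_convolution:
  assumes "0 < m"
  shows "(\<Sum>i\<le>m. cos_coeff' D i * cos_coeff' D (m - i))
    + D * (\<Sum>i<m. sinc_coeff D i * sinc_coeff D (m - 1 - i)) = 0"
proof -
  have 1: "(\<Sum>i\<le>m. cos_coeff' D i * cos_coeff' D (m - i))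
      = (- D) ^ m * (\<Sum>i\<le>m. 1 / (fact (2 * i) * fact (2 * (m - i))))"
    unfolding sum_distrib_left
    by (intro sum.cong) (auto simp: cos_coeff'_def power_add[symmetric])
  have 2: "(\<Sum>i<m. sinc_coeff D i * sinc_coeff D (m - 1 - i))
      = (- D) ^ (m - 1) * (\<Sum>i<m. 1 / (fact (2 * i + 1) * fact (2 * (m - 1 - i) + 1)))"
    unfolding sum_distrib_left
    by (intro sum.cong) (auto simp: sinc_coeff_def power_add[symmetric])
  have 3: "(- D) ^ m = - D * (- D) ^ (m - 1)"
    using assms by (cases m) auto
  show ?thesis
    unfolding 1 2 3 sum_inverse_fact_even_odd[OF assms] by simp
qed

text \<open>The factorial is that of \<open>w_norm_mult_sq_norm_poly_power\<close>; the coefficients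
  cancel it up to a binomial coefficient, which is at most \<open>4 ^ (a + b)\<close>.\<close>

lemma abs_cos_coeff_mult_le:
  assumes "0 \<le> D"
  shows "\<bar>cos_coeff' D a * cos_coeff' D b\<bar> * fact (2 * (a + b)) \<le> (4 * D) ^ (a + b)"
proof -
  have "\<bar>cos_coeff' D a * cos_coeff' D b\<bar> * fact (2 * (a + b))
      = D ^ (a + b) * (fact (2 * a + 2 * b) / (fact (2 * a) * fact (2 * b)))"
    using assms by (simp add: cos_coeff'_def abs_mult power_abs power_add)
  also have "\<dots> \<le> D ^ (a + b) * 2 ^ (2 * a + 2 * b)"
    using fact_add_le[of "2 * a" "2 * b"] assms
    by (intro mult_left_mono) (auto simp: field_simps)
  also have "\<dots> = (4 * D) ^ (a + b)"
    by (simp add: power_add power_mult power_mult_distrib)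
  finally show ?thesis .
qed

lemma abs_sinc_coeff_mult_le:
  assumes "0 \<le> D"
  shows "\<bar>D * (sinc_coeff D a * sinc_coeff D b)\<bar> * fact (2 * (a + b + 1)) \<le> (4 * D) ^ (a + b + 1)"
proof -
  have "\<bar>D * (sinc_coeff D a * sinc_coeff D b)\<bar> * fact (2 * (a + b + 1))
      = D ^ (a + b + 1) * (fact ((2 * a + 1) + (2 * b + 1)) / (fact (2 * a + 1) * fact (2 * b + 1)))"
    using assms by (simp add: sinc_coeff_def abs_mult power_abs power_add del: fact_Suc)
  also have "\<dots> \<le> D ^ (a + b + 1) * 2 ^ ((2 * a + 1) + (2 * b + 1))"
    using fact_add_le[of "2 * a + 1" "2 * b + 1"] assms
    by (intro mult_left_mono) (auto simp: field_simps simp del: fact_Suc)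
  also have "\<dots> = (4 * D) ^ (a + b + 1)"
    by (simp add: power_add power_mult power_mult_distrib)
  finally show ?thesis .
qed

text \<open>By \<open>cos\<^sup>2 + sin\<^sup>2 = 1\<close> only terms of degree above \<open>N\<close> in \<open>z\<close> survive.\<close>

lemma cos_error_eq:
  "(cos_error D N :: 'n::finite mpol) =
     (\<Sum>(a, b)\<in>{..N} \<times> {..N} - {(a, b). a + b \<le> N}.
        cst (cos_coeff' D a * cos_coeff' D b) * sq_norm_poly ^ (a + b)) +
     (\<Sum>(a, b)\<in>{..<N} \<times> {..<N} - {(a, b). a + b < N}.
        cst (D * (sinc_coeff D a * sinc_coeff D b)) * sq_norm_poly ^ (a + b + 1))"
proof -
  define G where "G a b = (cst (cos_coeff' D a * cos_coeff' D b) * sq_norm_poly ^ (a + b) :: 'n mpol)" for a b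
  define G' where "G' a b = (cst (D * (sinc_coeff D a * sinc_coeff D b))
    * sq_norm_poly ^ (a + b + 1) :: 'n mpol)" for a b
  have "cos_poly D N ^ 2 = (\<Sum>(a, b)\<in>{..N} \<times> {..N}. G a b)"
    by (simp add: cos_poly_def power2_eq_square sum_product sum.cartesian_product[symmetric] G_def
        cst_mult power_add mult_ac)
  also have "\<dots> = (\<Sum>(a, b)\<in>{..N} \<times> {..N} - {(a, b). a + b \<le> N}. G a b)
      + (\<Sum>(a, b)\<in>{(a, b). a + b \<le> N}. G a b)"
    by (rule sum.subset_diff) auto
  also have "(\<Sum>(a, b)\<in>{(a, b). a + b \<le> N}. G a b) = (\<Sum>m\<le>N. \<Sum>i\<le>m. G i (m - i))"
    by (rule sum.triangle_reindex_eq)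
  also have "(\<Sum>m\<le>N. \<Sum>i\<le>m. G i (m - i))
      = (\<Sum>m\<le>N. cst (\<Sum>i\<le>m. cos_coeff' D i * cos_coeff' D (m - i)) * sq_norm_poly ^ m)"
    by (intro sum.cong) (auto simp: G_def sum_distrib_right cst_sum)
  finally have 1: "cos_poly D N ^ 2 = (\<Sum>(a, b)\<in>{..N} \<times> {..N} - {(a, b). a + b \<le> N}. G a b)
      + (\<Sum>m\<le>N. cst (\<Sum>i\<le>m. cos_coeff' D i * cos_coeff' D (m - i)) * sq_norm_poly ^ m)" .
  have "cst D * sq_norm_poly * sinc_poly D N ^ 2 = (\<Sum>(a, b)\<in>{..<N} \<times> {..<N}. G' a b)"
    by (simp add: sinc_poly_def power2_eq_square sum_product sum.cartesian_product[symmetric] G'_def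
        cst_mult power_add mult_ac sum_distrib_left)
  also have "\<dots> = (\<Sum>(a, b)\<in>{..<N} \<times> {..<N} - {(a, b). a + b < N}. G' a b)
      + (\<Sum>(a, b)\<in>{(a, b). a + b < N}. G' a b)"
    by (rule sum.subset_diff) auto
  also have "(\<Sum>(a, b)\<in>{(a, b). a + b < N}. G' a b) = (\<Sum>m<N. \<Sum>i\<le>m. G' i (m - i))"
    by (rule sum.triangle_reindex)
  also have "(\<Sum>m<N. \<Sum>i\<le>m. G' i (m - i))
      = (\<Sum>m<N. cst (D * (\<Sum>i\<le>m. sinc_coeff D i * sinc_coeff D (m - i))) * sq_norm_poly ^ Suc m)"
    by (intro sum.cong) (auto simp: G'_def sum_distrib_right sum_distrib_left cst_sum)
  finally have 2: "cst D * sq_norm_poly * sinc_poly D N ^ 2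
      = (\<Sum>(a, b)\<in>{..<N} \<times> {..<N} - {(a, b). a + b < N}. G' a b)
      + (\<Sum>m<N. cst (D * (\<Sum>i\<le>m. sinc_coeff D i * sinc_coeff D (m - i))) * sq_norm_poly ^ Suc m)" .
  \<comment> \<open>The term at \<open>m = 0\<close> is the 1 that \<open>cos_error\<close>
    subtracts; the others are shifted to match the sine part.\<close>
  have 3: "(\<Sum>m\<le>N. cst (\<Sum>i\<le>m. cos_coeff' D i * cos_coeff' D (m - i)) * sq_norm_poly ^ m)
      = (1 :: 'n mpol) + (\<Sum>m<N. cst (\<Sum>i\<le>Suc m. cos_coeff' D i * cos_coeff' D (Suc m - i)) * sq_norm_poly ^ Suc m)"
    by (subst sum.atMost_shift) (simp add: cos_coeff'_def)
  have 4: "(\<Sum>m<N. cst (\<Sum>i\<le>Suc m. cos_coeff' D i * cos_coeff' D (Suc m - i)) * sq_norm_poly ^ Suc m)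
     + (\<Sum>m<N. cst (D * (\<Sum>i\<le>m. sinc_coeff D i * sinc_coeff D (m - i))) * sq_norm_poly ^ Suc m)
     = (0 :: 'n mpol)"
    unfolding sum.distrib[symmetric]
  proof (intro sum.neutral ballI)
    fix m
    have "(\<Sum>i\<le>Suc m. cos_coeff' D i * cos_coeff' D (Suc m - i))
        + D * (\<Sum>i\<le>m. sinc_coeff D i * sinc_coeff D (m - i)) = 0"
      using cos_sinc_coeff_convolution[of "Suc m" D] by (simp only: lessThan_Suc_atMost) simp
    then show "cst (\<Sum>i\<le>Suc m. cos_coeff' D i * cos_coeff' D (Suc m - i)) * sq_norm_poly ^ Suc m
        + cst (D * (\<Sum>i\<le>m. sinc_coeff D i * sinc_coeff D (m - i))) * sq_norm_poly ^ Suc m = (0 :: 'n mpol)"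
      by (simp only: distrib_right[symmetric] cst_add[symmetric]) simp
  qed
  have *: "(a + (1 + b)) + (c + d) - 1 = a + c" if "b + d = 0" for a b c d :: "'n mpol"
    using that by (simp add: algebra_simps)
  show ?thesis
    unfolding cos_error_def 1 2 3 G_def[symmetric] G'_def[symmetric] by (rule *[OF 4])
qed

section \<open>Density of the multiples of a power of \<open>1 + \<bar>X\<bar>\<^sup>2\<close>\<close>

text \<open>This \<open>D\<close> makes \<open>(4n) ^ j * (4D) ^ j\<close> equal to
  \<open>(1/4) ^ j\<close> for n variables. The error has at most \<open>2 * (N + 1)^2\<close>
  terms, all with \<open>j \<ge> N\<close>, so its norm is at most
  \<open>2 * C * (N + 1)^2 / 4 ^ N\<close>.\<close>

lemma cos_error_small:
  fixes H :: "'n::finite mpol"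
  assumes D: "D = 1 / (64 * real CARD('n))" and "0 < e"
  obtains N where "1 \<le> N" "w_norm (H * cos_error D N) < e"
proof -
  obtain C where C: "0 \<le> C"
    "\<And>j. w_norm (H * sq_norm_poly ^ j) \<le> C * (4 * real CARD('n)) ^ j * fact (2 * j)"
    using w_norm_mult_sq_norm_poly_power[of H] by blast
  have n: "0 < real CARD('n)" by simp
  have D0: "0 \<le> D" by (simp add: D)
  have term_le: "w_norm (H * (cst c * sq_norm_poly ^ j)) \<le> C * (1 / 4) ^ N"
    if "\<bar>c\<bar> * fact (2 * j) \<le> (4 * D) ^ j" "N \<le> j" for c j N
  proof -
    have "w_norm (H * (cst c * sq_norm_poly ^ j)) = \<bar>c\<bar> * w_norm (H * sq_norm_poly ^ j)"
      by (metis w_norm_cst_times mult.left_commute)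
    also have "\<dots> \<le> \<bar>c\<bar> * (C * (4 * real CARD('n)) ^ j * fact (2 * j))"
      by (intro mult_left_mono C) auto
    also have "\<dots> = C * (4 * real CARD('n)) ^ j * (\<bar>c\<bar> * fact (2 * j))" by simp
    also have "\<dots> \<le> C * (4 * real CARD('n)) ^ j * (4 * D) ^ j"
      by (intro mult_left_mono that C(1) mult_nonneg_nonneg) auto
    also have "\<dots> = C * (1 / 4) ^ j"
    proof -
      have "(4 * real CARD('n)) ^ j * (4 * D) ^ j = (1 / 4) ^ j"
        unfolding power_mult_distrib[symmetric] by (simp add: D)
      then show ?thesis by (simp only: mult.assoc)
    qed
    also have "\<dots> \<le> C * (1 / 4) ^ N"
      using that(2) by (intro mult_left_mono C(1) power_decreasing) auto
    finally show ?thesis .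
  qed
  have bound: "w_norm (H * cos_error D N) \<le> 2 * C * (real (Suc N) * (1 / 2) ^ N) ^ 2" for N
  proof -
    define A where "A = {..N} \<times> {..N} - {(a, b). a + b \<le> N}"
    define B where "B = {..<N} \<times> {..<N} - {(a, b). a + b < N}"
    have cA: "card A \<le> Suc N ^ 2" unfolding A_def
      by (rule order.trans[OF card_mono[of "{..N} \<times> {..N}"]]) (auto simp: power2_eq_square)
    have cB: "card B \<le> Suc N ^ 2" unfolding B_def
      by (rule order.trans[OF card_mono[of "{..N} \<times> {..N}"]]) (auto simp: power2_eq_square)
    have "w_norm (\<Sum>(a, b)\<in>A. H * (cst (cos_coeff' D a * cos_coeff' D b) * sq_norm_poly ^ (a + b)))
        \<le> (\<Sum>p\<in>A. C * (1 / 4) ^ N)"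
      by (intro order.trans[OF w_norm_sum] sum_mono)
        (auto simp: A_def intro!: term_le abs_cos_coeff_mult_le D0)
    also have "\<dots> = C * (1 / 4) ^ N * real (card A)" by simp
    also have "\<dots> \<le> C * (1 / 4) ^ N * real (Suc N ^ 2)"
      by (intro mult_left_mono of_nat_mono cA mult_nonneg_nonneg C(1)) simp
    finally have 1: "w_norm (\<Sum>(a, b)\<in>A. H * (cst (cos_coeff' D a * cos_coeff' D b)
      * sq_norm_poly ^ (a + b))) \<le> C * (1 / 4) ^ N * real (Suc N ^ 2)" .
    have "w_norm (\<Sum>(a, b)\<in>B. H * (cst (D * (sinc_coeff D a * sinc_coeff D b)) * sq_norm_poly ^ (a + b + 1)))
        \<le> (\<Sum>p\<in>B. C * (1 / 4) ^ N)"
      by (intro order.trans[OF w_norm_sum] sum_mono)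
        (auto simp: B_def simp del: mult_Suc_right power_Suc intro!: term_le abs_sinc_coeff_mult_le[simplified] D0)
    also have "\<dots> = C * (1 / 4) ^ N * real (card B)" by simp
    also have "\<dots> \<le> C * (1 / 4) ^ N * real (Suc N ^ 2)"
      by (intro mult_left_mono of_nat_mono cB mult_nonneg_nonneg C(1)) simp
    finally have 2: "w_norm (\<Sum>(a, b)\<in>B. H * (cst (D * (sinc_coeff D a * sinc_coeff D b))
      * sq_norm_poly ^ (a + b + 1))) \<le> C * (1 / 4) ^ N * real (Suc N ^ 2)" .
    have eq: "H * cos_error D N
        = (\<Sum>(a, b)\<in>A. H * (cst (cos_coeff' D a * cos_coeff' D b) * sq_norm_poly ^ (a + b)))
        + (\<Sum>(a, b)\<in>B. H * (cst (D * (sinc_coeff D a * sinc_coeff D b)) * sq_norm_poly ^ (a + b + 1)))"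
      unfolding cos_error_eq A_def[symmetric] B_def[symmetric]
      by (simp only: distrib_left sum_distrib_left case_prod_unfold)
    have "w_norm (H * cos_error D N) \<le> C * (1 / 4) ^ N * real (Suc N ^ 2) + C * (1 / 4) ^ N * real (Suc N ^ 2)"
      unfolding eq by (rule order.trans[OF w_norm_add add_mono[OF 1 2]])
    also have "\<dots> = 2 * C * (real (Suc N) * (1 / 2) ^ N) ^ 2"
    proof -
      have "((1 / 2 :: real) ^ N) ^ 2 = ((1 / 2) ^ 2) ^ N" by (simp only: power_mult[symmetric] mult.commute)
      then have "(1 / 4 :: real) ^ N = ((1 / 2) ^ N) ^ 2" by (simp add: power2_eq_square)
      then show ?thesis by (simp add: power_mult_distrib)
    qed
    finally show ?thesis .
  qed
  \<comment> \<open>The bound was written as a square so that this limit applies; the factor 2 below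
    makes up for the index shift.\<close>
  have "(\<lambda>N. real N * (1 / 2) ^ N) \<longlonglongrightarrow> 0"
    by (rule powser_times_n_limit_0) simp
  then have "(\<lambda>N. 2 * (real (Suc N) * (1 / 2) ^ Suc N)) \<longlonglongrightarrow> 2 * 0"
    by (intro tendsto_mult_left) (rule LIMSEQ_Suc)
  then have "(\<lambda>N. real (Suc N) * (1 / 2) ^ N) \<longlonglongrightarrow> 0" by (simp add: mult_ac)
  then have "(\<lambda>N. 2 * C * (real (Suc N) * (1 / 2) ^ N) ^ 2) \<longlonglongrightarrow> 2 * C * 0 ^ 2"
    by (intro tendsto_intros)
  then have "eventually (\<lambda>N. 2 * C * (real (Suc N) * (1 / 2) ^ N) ^ 2 < e) sequentially"
    using \<open>0 < e\<close> by (intro order_tendstoD(2)) auto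
  then have "eventually (\<lambda>N. w_norm (H * cos_error D N) < e \<and> 1 \<le> N) sequentially"
    using eventually_ge_at_top[of 1] by eventually_elim (use bound in \<open>auto intro: le_less_trans\<close>)
  then show thesis using that by (auto simp: eventually_sequentially)
qed

section \<open>Contraction of residues modulo \<open>one_plus_sq\<close>\<close>

definition one_plus_sq :: "'n::finite mpol" where
  "one_plus_sq = 1 + sq_norm_poly"

lemma one_plus_sq_sos [simp, intro]: "one_plus_sq \<in> sos"
  unfolding one_plus_sq_def by auto

lemma minus_dvd_power_diff: "x - y dvd x ^ k - y ^ k" for x y :: "'a::comm_ring_1"
proof (induction k)
  case (Suc k)
  have "x ^ Suc k - y ^ Suc k = (x - y) * x ^ k + y * (x ^ k - y ^ k)"
    by (simp add: algebra_simps)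
  then show ?case using Suc.IH by simp
qed simp

text \<open>The value \<open>c\<close> of \<open>cos_poly\<close> at \<open>z = -1\<close> is a truncation of \<open>cosh \<delta>\<close>.\<close>

lemma cos_poly_at_minus_one:
  assumes "0 \<le> D" "1 \<le> N"
  obtains c where "1 + D / 2 \<le> c" "(one_plus_sq :: 'n::finite mpol) dvd cst c - cos_poly D N"
proof
  define c where "c = (\<Sum>a\<le>N. D ^ a / fact (2 * a))"
  \<comment> \<open>All terms are nonnegative, and the first two are present because
    \<open>1 \<le> N\<close>.\<close>
  have "(\<Sum>a\<le>1. D ^ a / fact (2 * a)) \<le> c"
    unfolding c_def using assms by (intro sum_mono2) auto
  then show "1 + D / 2 \<le> c" by (simp add: fact_numeral)
  have c: "cst c = (\<Sum>a\<le>N. cst (cos_coeff' D a) * (- 1 :: 'n mpol) ^ a)"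
  proof -
    have "cst (cos_coeff' D a) * (- 1 :: 'n mpol) ^ a = cst (D ^ a / fact (2 * a))" for a
    proof -
      have "(- 1 :: 'n mpol) ^ a = cst ((- 1) ^ a)" by (simp add: cst_power single_uminus)
      then have "cst (cos_coeff' D a) * (- 1 :: 'n mpol) ^ a = cst (cos_coeff' D a * (- 1) ^ a)"
        by (simp only: cst_mult)
      also have "cos_coeff' D a * (- 1) ^ a = D ^ a / fact (2 * a)"
        by (simp add: cos_coeff'_def flip: power_mult_distrib)
      finally show ?thesis .
    qed
    then show ?thesis by (simp add: c_def cst_sum)
  qed
  have "cst c - cos_poly D N
      = (\<Sum>a\<le>N. cst (cos_coeff' D a) * ((- 1 :: 'n mpol) ^ a - sq_norm_poly ^ a))"
    by (simp add: c cos_poly_def sum_subtractf right_diff_distrib)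
  moreover have "one_plus_sq dvd (- 1 :: 'n mpol) ^ a - sq_norm_poly ^ a" for a
  proof -
    have "(one_plus_sq :: 'n mpol) = - ((- 1) - sq_norm_poly)" by (simp add: one_plus_sq_def)
    then show ?thesis by (metis minus_dvd_iff minus_dvd_power_diff)
  qed
  ultimately show "(one_plus_sq :: 'n mpol) dvd cst c - cos_poly D N"
    by (simp only:) (intro dvd_sum dvd_mult)
qed

text \<open>One step replaces \<open>q\<close> by \<open>cos (\<delta> \<bar>X\<bar>) q / cosh \<delta>\<close>. This does not change the residue class
  modulo \<open>1 + \<bar>X\<bar>\<^sup>2\<close>, since \<open>cosh \<delta> - cos (\<delta> \<surd>z)\<close> vanishes at \<open>z = -1\<close>, and it shrinks \<open>q\<^sup>2\<close> by the factor
  \<open>cosh\<^sup>2 \<delta>\<close>, since \<open>1 - cos\<^sup>2\<close> is a sum of squares.\<close>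

lemma residue_class_contract:
  fixes p H :: "'n::finite mpol"
  assumes H: "H \<in> sos" and "0 < \<epsilon>"
  shows "\<exists>q e. one_plus_sq dvd p - q \<and> w_norm e < \<epsilon> \<and>
    cst ((1 / (1 + 1 / (128 * real CARD('n)))\<^sup>2) ^ k) * (H * p\<^sup>2) + e - H * q\<^sup>2 \<in> sos"
  using assms(2)
proof (induction k arbitrary: \<epsilon>)
  case 0
  then show ?case by (intro exI[of _ p] exI[of _ 0]) (simp add: w_norm_0)
next
  case (Suc k)
  define D where "D = 1 / (64 * real CARD('n))"
  \<comment> \<open>This is \<open>1 + D / 2\<close>, a lower bound for every truncation of
    \<open>cosh\<close> that may occur. Being independent of \<open>N\<close>, it gives the same
    contraction factor in each step.\<close>
  define c0 where "c0 = 1 + 1 / (128 * real CARD('n))"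
  define \<kappa> where "\<kappa> = (1 / c0\<^sup>2) ^ k"
  have c0: "1 \<le> c0" by (simp add: c0_def)
  have D0: "0 \<le> D" by (simp add: D_def)
  have \<kappa>: "0 \<le> \<kappa>" by (simp add: \<kappa>_def)
  from Suc.IH[of "\<epsilon> / 2"] Suc.prems obtain q e where q: "one_plus_sq dvd p - q" "w_norm e < \<epsilon> / 2"
    and s: "cst \<kappa> * (H * p\<^sup>2) + e - H * q\<^sup>2 \<in> sos"
    by (auto simp: \<kappa>_def c0_def)
  \<comment> \<open>\<open>N\<close> is chosen after \<open>q\<close>, since the truncation error
    enters multiplied by \<open>H * q\<^sup>2\<close>.\<close>
  obtain N where N: "1 \<le> N" "w_norm (H * q\<^sup>2 * cos_error D N) < \<epsilon> / 2"
    using cos_error_small[OF D_def, of "\<epsilon> / 2" "H * q\<^sup>2"] Suc.prems by auto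
  obtain c where c: "1 + D / 2 \<le> c" "(one_plus_sq :: 'n mpol) dvd cst c - cos_poly D N"
    using cos_poly_at_minus_one[OF D0 N(1)] by blast
  have cc: "c0 \<le> c" using c(1) by (simp add: c0_def D_def)
  then have c1: "1 \<le> c" using c0 by simp
  define T where "T = (cos_poly D N :: 'n mpol)"
  define i where "i = 1 / c"
  have i: "0 \<le> i" "i \<le> 1" "i * c = 1" using c1 by (simp_all add: i_def)
  have ii: "i\<^sup>2 \<le> 1 / c0\<^sup>2"
    using cc c0 by (auto simp: i_def power_divide intro!: divide_left_mono power_mono mult_pos_pos)
  define q' where "q' = cst i * (T * q)"
  define e' where "e' = cst (i\<^sup>2) * (e + H * q\<^sup>2 * cos_error D N)"
  have "q - q' = cst i * q * (cst c - T)"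
  proof -
    have "cst i * cst c = (1 :: 'n mpol)" using i(3) by (simp add: cst_mult[symmetric])
    then have "q = cst i * cst c * q" by simp
    then have "q - q' = cst i * cst c * q - cst i * (T * q)" unfolding q'_def by metis
    then show ?thesis by (simp add: algebra_simps)
  qed
  then have "one_plus_sq dvd q - q'" using c(2) unfolding T_def by simp
  then have d: "one_plus_sq dvd p - q'"
    using dvd_add[OF q(1), of "q - q'"] by simp
  have "w_norm e' = i\<^sup>2 * w_norm (e + H * q\<^sup>2 * cos_error D N)"
    unfolding e'_def w_norm_cst_times by simp
  also have "\<dots> \<le> w_norm (e + H * q\<^sup>2 * cos_error D N)"
    using i by (intro mult_left_le_one_le w_norm_nonneg) (auto simp: power_le_one)
  also have "\<dots> < \<epsilon>" using w_norm_add[of e "H * q\<^sup>2 * cos_error D N"] q(2) N(2) by linarith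
  finally have e': "w_norm e' < \<epsilon>" .
  have T2: "T\<^sup>2 = 1 + cos_error D N - cst D * sq_norm_poly * (sinc_poly D N)\<^sup>2"
    by (simp add: cos_error_def T_def)
  \<comment> \<open>Inserting \<open>T2\<close>, the cosine error cancels against the one in
    \<open>e'\<close>. What remains is the slack between \<open>i\<^sup>2\<close> and
    \<open>1 / c0\<^sup>2\<close>, the induction hypothesis scaled by \<open>i\<^sup>2\<close>, and
    the sine part.\<close>
  have "cst ((1 / c0\<^sup>2) ^ Suc k) * (H * p\<^sup>2) + e' - H * q'\<^sup>2 =
      cst (\<kappa> * (1 / c0\<^sup>2 - i\<^sup>2)) * (H * p\<^sup>2)
      + cst (i\<^sup>2) * (cst \<kappa> * (H * p\<^sup>2) + e - H * q\<^sup>2)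
      + cst (i\<^sup>2 * D) * (H * q\<^sup>2 * sq_norm_poly * (sinc_poly D N)\<^sup>2)"
  proof -
    have q'2: "q'\<^sup>2 = cst (i\<^sup>2) * (T\<^sup>2 * q\<^sup>2)" by (simp add: q'_def power_mult_distrib cst_power)
    have k1: "cst ((1 / c0\<^sup>2) ^ Suc k) = cst (\<kappa> * (1 / c0\<^sup>2 - i\<^sup>2)) + cst (i\<^sup>2) * (cst \<kappa> :: 'n mpol)"
      by (simp only: cst_mult[symmetric] cst_add[symmetric]) (simp add: \<kappa>_def algebra_simps)
    show ?thesis unfolding q'2 T2 k1 e'_def cst_mult[of "i\<^sup>2" D] by (simp add: algebra_simps)
  qed
  moreover have "\<dots> \<in> sos"
    using ii \<kappa> H D0 s by (intro sos_add sos_cst_mult sos_mult) auto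
  ultimately have "cst ((1 / c0\<^sup>2) ^ Suc k) * (H * p\<^sup>2) + e' - H * q'\<^sup>2 \<in> sos" by simp
  with d e' show ?case unfolding c0_def by blast
qed

text \<open>Contract the residue class of \<open>p\<close> until the factor \<open>c ^ k\<close>
  makes \<open>H * p\<^sup>2\<close> negligible. Membership in \<open>sos\<close> replaces the
  statement that a functional nonnegative on squares is small on
  \<open>H * (p - one_plus_sq * u)\<^sup>2\<close>.\<close>

lemma density_one_plus_sq:
  fixes p H :: "'n::finite mpol"
  assumes H: "H \<in> sos" and "0 < \<epsilon>"
  obtains u e where "w_norm e < \<epsilon>" "e - H * (p - one_plus_sq * u)\<^sup>2 \<in> sos"
proof -
  define c where "c = 1 / (1 + 1 / (128 * real CARD('n)))\<^sup>2"
  have "1 < (1 + 1 / (128 * real CARD('n)))\<^sup>2" by (simp add: one_less_power)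
  then have c: "0 \<le> c" "c < 1" unfolding c_def by (simp, subst divide_less_eq_1) auto
  define W where "W = w_norm (H * p\<^sup>2)"
  have W: "0 \<le> W" by (simp add: W_def w_norm_nonneg)
  obtain k where k: "c ^ k < \<epsilon> / (2 * (W + 1))"
    using real_arch_pow_inv[OF _ c(2), of "\<epsilon> / (2 * (W + 1))"] W \<open>0 < \<epsilon>\<close> by auto
  obtain q e where q: "one_plus_sq dvd p - q" "w_norm e < \<epsilon> / 2"
    "cst (c ^ k) * (H * p\<^sup>2) + e - H * q\<^sup>2 \<in> sos"
    using residue_class_contract[OF H, of "\<epsilon> / 2" p k] \<open>0 < \<epsilon>\<close> unfolding c_def by auto
  obtain u where u: "p - q = one_plus_sq * u" using q(1) by (rule dvdE)
  have "c ^ k * W \<le> c ^ k * (W + 1)" using c by (intro mult_left_mono) auto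
  also have "\<dots> < \<epsilon> / 2" using k W by (simp add: field_simps)
  finally have "w_norm (cst (c ^ k) * (H * p\<^sup>2)) < \<epsilon> / 2"
    unfolding w_norm_cst_times W_def using c by simp
  then have "w_norm (cst (c ^ k) * (H * p\<^sup>2) + e) < \<epsilon>"
    using w_norm_add[of "cst (c ^ k) * (H * p\<^sup>2)" e] q(2) by linarith
  moreover have "q = p - one_plus_sq * u" using u by (simp add: algebra_simps)
  ultimately show thesis using that q(3) by metis
qed

text \<open>After approximating \<open>p\<close> by \<open>one_plus_sq ^ m * u\<close>, approximate
  \<open>u\<close> by a multiple of \<open>one_plus_sq\<close> with the weight
  \<open>H * (one_plus_sq ^ m)\<^sup>2\<close>; this is why \<open>H\<close> is arbitrary. The two
  errors combine by \<open>2 a\<^sup>2 + 2 b\<^sup>2 - (a + b)\<^sup>2 = (a -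
  b)\<^sup>2\<close>.\<close>

lemma density_one_plus_sq_power:
  fixes p H :: "'n::finite mpol"
  assumes "H \<in> sos" "0 < \<epsilon>"
  shows "\<exists>u e. w_norm e < \<epsilon> \<and> e - H * (p - one_plus_sq ^ m * u)\<^sup>2 \<in> sos"
  using assms
proof (induction m arbitrary: H \<epsilon>)
  case 0
  then show ?case by (intro exI[of _ p] exI[of _ 0]) (simp add: w_norm_0)
next
  case (Suc m)
  from Suc.IH[of H "\<epsilon> / 4"] Suc.prems obtain u e where
    u: "w_norm e < \<epsilon> / 4" "e - H * (p - one_plus_sq ^ m * u)\<^sup>2 \<in> sos" by auto
  have "H * (one_plus_sq ^ m)\<^sup>2 \<in> sos" using Suc.prems by auto
  then obtain u' e' where
    u': "w_norm e' < \<epsilon> / 4" "e' - H * (one_plus_sq ^ m)\<^sup>2 * (u - one_plus_sq * u')\<^sup>2 \<in> sos"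
    by (rule density_one_plus_sq[of _ "\<epsilon> / 4" u]) (use Suc.prems in auto)
  define a where "a = p - one_plus_sq ^ m * u"
  define b where "b = one_plus_sq ^ m * (u - one_plus_sq * u')"
  have ab: "p - one_plus_sq ^ Suc m * u' = a + b"
    by (simp add: a_def b_def algebra_simps)
  have "(e + e) + (e' + e') - H * (a + b)\<^sup>2
      = (e - H * a\<^sup>2) + (e - H * a\<^sup>2) + (e' - H * b\<^sup>2) + (e' - H * b\<^sup>2) + H * (a - b)\<^sup>2"
    by (simp add: power2_eq_square algebra_simps)
  moreover have "\<dots> \<in> sos"
    using u(2) u'(2) Suc.prems(1)
    by (intro sos_add sos_mult) (auto simp: a_def b_def power_mult_distrib mult.assoc)
  ultimately have "(e + e) + (e' + e') - H * (p - one_plus_sq ^ Suc m * u')\<^sup>2 \<in> sos"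
    unfolding ab by metis
  moreover have "w_norm ((e + e) + (e' + e')) < \<epsilon>"
    using w_norm_add[of "e + e" "e' + e'"] w_norm_add[of e e] w_norm_add[of e' e'] u(1) u'(1) by linarith
  ultimately show ?case by blast
qed

section \<open>Positive polynomials on a cube\<close>

text \<open>Inductive, and on functions, so that pulling back along the chart is an induction over
  these rules.\<close>

inductive handelman :: "(real ^ 'm::finite \<Rightarrow> real) \<Rightarrow> bool" where
  const: "0 \<le> c \<Longrightarrow> handelman (\<lambda>_. c)"
| coord: "handelman (\<lambda>t. t $ i)"
| compl: "handelman (\<lambda>t. 1 - t $ i)"
| add: "handelman F \<Longrightarrow> handelman G \<Longrightarrow> handelman (\<lambda>t. F t + G t)"
| mult: "handelman F \<Longrightarrow> handelman G \<Longrightarrow> handelman (\<lambda>t. F t * G t)"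

lemma handelman_sum:
  "(\<And>a. a \<in> A \<Longrightarrow> handelman (F a)) \<Longrightarrow> handelman (\<lambda>t. \<Sum>a\<in>A. F a t)"
  by (induction A rule: infinite_finite_induct) (auto intro: handelman.intros)

lemma handelman_prod:
  "(\<And>a. a \<in> A \<Longrightarrow> handelman (F a)) \<Longrightarrow> handelman (\<lambda>t. \<Prod>a\<in>A. F a t)"
  by (induction A rule: infinite_finite_induct) (auto intro: handelman.intros)

lemma handelman_power: "handelman F \<Longrightarrow> handelman (\<lambda>t. F t ^ k)"
  by (induction k) (auto intro: handelman.intros)

section \<open>Bernstein expansions\<close>

definition bernstein :: "nat \<Rightarrow> nat \<Rightarrow> real \<Rightarrow> real" where
  "bernstein D k t = real (D choose k) * t ^ k * (1 - t) ^ (D - k)"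

lemma handelman_bernstein: "handelman (\<lambda>t. bernstein D k (t $ i))"
  unfolding bernstein_def
  by (intro handelman.mult handelman_power handelman.const handelman.coord handelman.compl) auto

text \<open>Multiply \<open>t ^ a\<close> by \<open>(t + (1 - t)) ^ (D - a)\<close> and
  expand.\<close>

lemma power_bernstein_expansion:
  assumes "a \<le> D"
  shows "t ^ a = (\<Sum>k\<le>D. real (k choose a) / real (D choose a) * bernstein D k t)"
proof -
  have pos: "0 < real (D choose a)" using assms by simp
  have "real (D choose a) * t ^ a = real (D choose a) * t ^ a * (t + (1 - t)) ^ (D - a)" by simp
  also have "\<dots> = (\<Sum>j\<le>D - a. real (D choose a) * t ^ a *
      (real (D - a choose j) * t ^ j * (1 - t) ^ (D - a - j)))"
    by (subst binomial_ring) (simp add: sum_distrib_left)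
  also have "\<dots> = (\<Sum>k\<in>{a..D}. real (k choose a) * bernstein D k t)"
  proof (rule sum.reindex_bij_witness[of _ "\<lambda>k. k - a" "\<lambda>j. a + j"])
    fix j assume "j \<in> {..D - a}"
    then have j: "a + j \<le> D" using assms by auto
    have "real (D choose a) * real (D - a choose j) = real (D choose (a + j)) * real (a + j choose a)"
      using choose_mult[of a "a + j" D] j by (simp flip: of_nat_mult)
    then show "real (a + j choose a) * bernstein D (a + j) t = real (D choose a) * t ^ a *
      (real (D - a choose j) * t ^ j * (1 - t) ^ (D - a - j))"
      by (simp add: bernstein_def power_add mult_ac)
  qed (use assms in auto)
  also have "\<dots> = (\<Sum>k\<le>D. real (k choose a) * bernstein D k t)"
    by (rule sum.mono_neutral_left) auto
  finally show ?thesis using pos by (simp add: sum_divide_distrib[symmetric] field_simps)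
qed

lemma binomial_ratio_eq_prod:
  assumes "a \<le> D"
  shows "real (k choose a) / real (D choose a) = (\<Prod>j<a. (real k - real j) / (real D - real j))"
  by (simp add: binomial_gbinomial gbinomial_prod_rev prod_dividef atLeast0LessThan)

text \<open>The ratio is a product of the \<open>a\<close> factors \<open>(k - j) / (D - j)\<close>.
  For \<open>a \<le> k\<close> they lie in the unit interval, so their deviations from
  \<open>k / D\<close>, each at most \<open>a / (D - a)\<close>, simply add up.\<close>

lemma binomial_ratio_approx:
  assumes "a < D" "k \<le> D"
  shows "\<bar>real (k choose a) / real (D choose a) - (real k / real D) ^ a\<bar> \<le> real a * real a / (real D - real a)"
proof (cases "a \<le> k")
  case True
  have le1: "norm ((real k - real j) / (real D - real j)) \<le> 1" if "j < a" for j
    using that assms True by (auto simp: divide_simps)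
  have "norm ((\<Prod>j<a. (real k - real j) / (real D - real j)) - (\<Prod>j<a. real k / real D))
      \<le> (\<Sum>j<a. norm ((real k - real j) / (real D - real j) - real k / real D))"
    using assms le1 by (intro norm_prod_diff) (auto simp: divide_simps)
  also have "\<dots> \<le> (\<Sum>j<a. real a / (real D - real a))"
  proof (rule sum_mono)
    fix j assume j: "j \<in> {..<a}"
    have "(real k - real j) / (real D - real j) - real k / real D
        = - (real j * (real D - real k) / (real D * (real D - real j)))"
      using j assms by (simp add: field_simps)
    then have "norm ((real k - real j) / (real D - real j) - real k / real D)
        = (real j / (real D - real j)) * ((real D - real k) / real D)"
      using j assms by (simp add: abs_mult abs_divide mult_ac)
    also have "\<dots> \<le> (real j / (real D - real j)) * 1"
      using j assms by (intro mult_left_mono) auto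
    also have "\<dots> \<le> real a / (real D - real a)"
      using j assms by (auto intro!: frac_le)
    finally show "norm ((real k - real j) / (real D - real j) - real k / real D)
        \<le> real a / (real D - real a)" .
  qed
  finally show ?thesis
    using assms by (simp add: binomial_ratio_eq_prod)
next
  \<comment> \<open>Here the binomial ratio is 0, and \<open>k / D\<close> is itself small because
    \<open>k < a\<close>.\<close>
  case False
  then have "\<bar>real (k choose a) / real (D choose a) - (real k / real D) ^ a\<bar> = (real k / real D) ^ a"
    by (simp add: binomial_eq_0)
  also have "\<dots> \<le> (real k / real D) ^ 1"
    using False assms by (intro power_decreasing) auto
  also have "\<dots> \<le> real a * real a / (real D - real a)"
  proof -
    have "real k * 1 \<le> real a * real a" using False by (intro mult_mono) auto
    then show ?thesis using False assms by (auto intro!: frac_le)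
  qed
  finally show ?thesis .
qed

text \<open>The coefficients of \<open>p\<close> in the Bernstein basis of degree \<open>D\<close> converge uniformly to the values
  of \<open>p\<close> on the grid \<open>{0, 1/D, \<dots>, 1}\<close>, hence are eventually nonnegative.\<close>

lemma handelman_if_pos_on_cube:
  fixes p :: "'m::finite mpol"
  assumes pos: "\<And>t. t \<in> cbox 0 1 \<Longrightarrow> 0 < eval p t"
  shows "handelman (eval p)"
proof -
  have "(0 :: real ^ 'm) \<in> cbox 0 1" by (simp add: mem_box_cart)
  then obtain t0 where t0: "t0 \<in> cbox 0 (1 :: real ^ 'm)" "\<And>t. t \<in> cbox 0 1 \<Longrightarrow> eval p t0 \<le> eval p t"
    using continuous_attains_inf[of "cbox 0 (1 :: real ^ 'm)" "eval p"]
    by (metis compact_cbox continuous_on_eval empty_iff)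
  define \<mu> where "\<mu> = eval p t0"
  have \<mu>: "0 < \<mu>" unfolding \<mu>_def by (rule pos[OF t0(1)])
  define A where "A = Max (insert 0 (mdeg ` Poly_Mapping.keys p))"
  have A: "Poly_Mapping.lookup s i \<le> A" if "s \<in> Poly_Mapping.keys p" for s i
  proof -
    have "Poly_Mapping.lookup s i \<le> mdeg s" unfolding mdeg_def by (rule member_le_sum) auto
    also have "\<dots> \<le> A" unfolding A_def using that by (intro Max_ge) auto
    finally show ?thesis .
  qed
  define L where "L = (\<Sum>s\<in>Poly_Mapping.keys p. \<bar>Poly_Mapping.lookup p s\<bar>)"
  define B where "B = L * real CARD('m) * (real A * real A)"
  have B0: "0 \<le> B" unfolding B_def L_def by (intro mult_nonneg_nonneg sum_nonneg) auto
  \<comment> \<open>\<open>B / (D - A)\<close> will bound the distance of a Bernstein coefficient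
    from the value at its grid point; \<open>E\<close> brings it below the minimum
    \<open>\<mu>\<close>.\<close>
  obtain E :: nat where E: "B / \<mu> < real E" using reals_Archimedean2 by blast
  define D where "D = A + Suc E"
  have D: "A < D" "B / (real D - real A) < \<mu>"
    using E \<mu> B0 by (auto simp: D_def field_simps)
  define \<beta> where "\<beta> k = (\<Sum>s\<in>Poly_Mapping.keys p. Poly_Mapping.lookup p s *
    (\<Prod>i\<in>UNIV. real (k i choose Poly_Mapping.lookup s i) / real (D choose Poly_Mapping.lookup s i)))"
    for k :: "'m \<Rightarrow> nat"
  have \<beta>: "0 \<le> \<beta> k" if k: "k \<in> UNIV \<rightarrow>\<^sub>E {..D}" for k
  proof -
    have kD: "k i \<le> D" for i using k by (auto simp: PiE_def Pi_def)
    define y where "y = (\<chi> i. real (k i) / real D)"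
    have y: "y \<in> cbox 0 1" using kD D(1) by (auto simp: y_def mem_box_cart divide_simps)
    have "\<bar>\<beta> k - eval p y\<bar> \<le> (\<Sum>s\<in>Poly_Mapping.keys p. \<bar>Poly_Mapping.lookup p s\<bar> *
        \<bar>(\<Prod>i\<in>UNIV. real (k i choose Poly_Mapping.lookup s i) / real (D choose Poly_Mapping.lookup s i))
          - mono_eval y s\<bar>)"
      unfolding \<beta>_def eval_superset[OF finite_keys order_refl] sum_subtractf[symmetric]
        right_diff_distrib[symmetric] abs_mult[symmetric] by (rule sum_abs)
    also have "\<dots> \<le> (\<Sum>s\<in>Poly_Mapping.keys p. \<bar>Poly_Mapping.lookup p s\<bar> *
        (real CARD('m) * (real A * real A / (real D - real A))))"
    proof (intro sum_mono mult_left_mono abs_ge_zero)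
      fix s assume s: "s \<in> Poly_Mapping.keys p"
      have "norm ((\<Prod>i\<in>UNIV. real (k i choose Poly_Mapping.lookup s i) / real (D choose Poly_Mapping.lookup s i))
          - (\<Prod>i\<in>UNIV. (real (k i) / real D) ^ Poly_Mapping.lookup s i))
        \<le> (\<Sum>i\<in>UNIV. norm (real (k i choose Poly_Mapping.lookup s i) / real (D choose Poly_Mapping.lookup s i)
          - (real (k i) / real D) ^ Poly_Mapping.lookup s i))"
      proof (rule norm_prod_diff)
        fix i
        have "real (k i choose Poly_Mapping.lookup s i) \<le> real (D choose Poly_Mapping.lookup s i)"
          by (intro of_nat_mono binomial_right_mono kD)
        then show "norm (real (k i choose Poly_Mapping.lookup s i) / real (D choose Poly_Mapping.lookup s i)) \<le> 1"
          by (auto simp: divide_simps)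
        show "norm ((real (k i) / real D) ^ Poly_Mapping.lookup s i) \<le> 1"
          using kD[of i] D(1) by (auto simp: norm_power intro!: power_le_one) 
      qed
      also have "\<dots> \<le> (\<Sum>i\<in>(UNIV :: 'm set). real A * real A / (real D - real A))"
      proof (rule sum_mono)
        fix i
        have a: "Poly_Mapping.lookup s i < D" using A[OF s, of i] D(1) by simp
        have "norm (real (k i choose Poly_Mapping.lookup s i) / real (D choose Poly_Mapping.lookup s i)
          - (real (k i) / real D) ^ Poly_Mapping.lookup s i)
          \<le> real (Poly_Mapping.lookup s i) * real (Poly_Mapping.lookup s i) / (real D - real (Poly_Mapping.lookup s i))"
          using binomial_ratio_approx[OF a kD] by simp
        also have "\<dots> \<le> real A * real A / (real D - real A)"
          using A[OF s, of i] D(1) by (intro frac_le mult_mono) auto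
        finally show "norm (real (k i choose Poly_Mapping.lookup s i) / real (D choose Poly_Mapping.lookup s i)
          - (real (k i) / real D) ^ Poly_Mapping.lookup s i) \<le> real A * real A / (real D - real A)" .
      qed
      finally show "\<bar>(\<Prod>i\<in>UNIV. real (k i choose Poly_Mapping.lookup s i) / real (D choose Poly_Mapping.lookup s i))
          - mono_eval y s\<bar> \<le> real CARD('m) * (real A * real A / (real D - real A))"
        by (simp add: mono_eval_def y_def)
    qed
    also have "\<dots> = B / (real D - real A)"
      by (simp only: sum_distrib_right[symmetric]) (simp add: B_def L_def)
    finally have "\<bar>\<beta> k - eval p y\<bar> < \<mu>" using D(2) by linarith
    moreover have "\<mu> \<le> eval p y" unfolding \<mu>_def by (rule t0(2)[OF y])
    ultimately show ?thesis by linarith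
  qed
  \<comment> \<open>Each monomial is a product of univariate Bernstein expansions, multiplied out
    into a sum over all grid indices.\<close>
  have "eval p t = (\<Sum>k\<in>UNIV \<rightarrow>\<^sub>E {..D}. \<beta> k * (\<Prod>i\<in>UNIV. bernstein D (k i) (t $ i)))" for t
  proof -
    have "mono_eval t s = (\<Sum>k\<in>UNIV \<rightarrow>\<^sub>E {..D}.
        (\<Prod>i\<in>UNIV. real (k i choose Poly_Mapping.lookup s i) / real (D choose Poly_Mapping.lookup s i)) *
        (\<Prod>i\<in>UNIV. bernstein D (k i) (t $ i)))" if s: "s \<in> Poly_Mapping.keys p" for s
    proof -
      have "mono_eval t s = (\<Prod>i\<in>UNIV. \<Sum>k\<le>D.
          real (k choose Poly_Mapping.lookup s i) / real (D choose Poly_Mapping.lookup s i) * bernstein D k (t $ i))"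
        unfolding mono_eval_def
      proof (intro prod.cong refl)
        fix i
        show "(t $ i) ^ Poly_Mapping.lookup s i = (\<Sum>k\<le>D.
          real (k choose Poly_Mapping.lookup s i) / real (D choose Poly_Mapping.lookup s i) * bernstein D k (t $ i))"
          using A[OF s, of i] D(1) by (intro power_bernstein_expansion) simp
      qed
      then show ?thesis by (subst (asm) prod_sum_PiE) (simp_all only: prod.distrib finite_atMost finite_code)
    qed
    then have "eval p t = (\<Sum>s\<in>Poly_Mapping.keys p. Poly_Mapping.lookup p s * (\<Sum>k\<in>UNIV \<rightarrow>\<^sub>E {..D}.
        (\<Prod>i\<in>UNIV. real (k i choose Poly_Mapping.lookup s i) / real (D choose Poly_Mapping.lookup s i)) *
        (\<Prod>i\<in>UNIV. bernstein D (k i) (t $ i))))"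
      by (simp add: eval_superset[OF finite_keys order_refl])
    also have "\<dots> = (\<Sum>k\<in>UNIV \<rightarrow>\<^sub>E {..D}. \<beta> k * (\<Prod>i\<in>UNIV. bernstein D (k i) (t $ i)))"
      unfolding sum_distrib_left \<beta>_def sum_distrib_right
      by (subst sum.swap) (simp only: mult.assoc)
    finally show ?thesis .
  qed
  then have "eval p = (\<lambda>t. \<Sum>k\<in>UNIV \<rightarrow>\<^sub>E {..D}. \<beta> k * (\<Prod>i\<in>UNIV. bernstein D (k i) (t $ i)))"
    by (rule ext)
  then show ?thesis
    using \<beta> by (auto intro!: handelman_sum handelman.mult handelman.const handelman_prod handelman_bernstein)
qed

section \<open>Removal of the constraints\<close>

lemma mult_one_minus_power_le:
  fixes x :: real
  assumes "x \<le> 1" "0 < k"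
  shows "(1 - x) ^ k * x \<le> 1 / real k"
proof (cases "0 \<le> x")
  case True
  have "(1 - x) ^ k * (real k * x) \<le> (1 - x) ^ k * (1 + x) ^ k"
    using True assms Bernoulli_inequality[of x k] by (intro mult_left_mono) auto
  also have "\<dots> = (1 - x\<^sup>2) ^ k"
    by (simp add: power_mult_distrib[symmetric] algebra_simps power2_eq_square)
  also have "\<dots> \<le> 1"
    using True assms by (intro power_le_one) (auto simp: power_le_one)
  finally show ?thesis using assms(2) by (simp add: field_simps)
next
  case False
  then have "(1 - x) ^ k * x \<le> 0" by (intro mult_nonneg_nonpos) auto
  then show ?thesis by (rule order_trans) simp
qed

text \<open>The weights \<open>(1 - h)\<^bsup>2k\<^esup>\<close> make \<open>(1 - h)\<^bsup>2k\<^esup> h\<close> tend to \<open>0\<close> uniformly where \<open>0 \<le> h \<le> 1\<close>, while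
  it stays below \<open>h\<close> where \<open>h < 0\<close>.\<close>

lemma constraint_removal:
  fixes F :: "'a::topological_space \<Rightarrow> real"
  assumes Q: "compact Q" and J: "finite J"
    and F: "continuous_on Q F" and h: "\<And>j. j \<in> J \<Longrightarrow> continuous_on Q (h j)"
    and h1: "\<And>j t. j \<in> J \<Longrightarrow> t \<in> Q \<Longrightarrow> h j t \<le> 1"
    and pos: "\<And>t. t \<in> Q \<Longrightarrow> (\<forall>j\<in>J. 0 \<le> h j t) \<Longrightarrow> 0 < F t"
  obtains c k where "(0::real) \<le> c"
    "\<And>t. t \<in> Q \<Longrightarrow> 0 < F t - c * (\<Sum>j\<in>J. (1 - h j t) ^ (2 * k) * h j t)"
proof (cases "Q = {}")
  case True
  then show thesis using that[of 0 0] by simp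
next
  case False
  \<comment> \<open>Positive at every point of \<open>Q\<close>: either \<open>F\<close> is positive
    or some constraint is violated. Compactness bounds it away from 0.\<close>
  define m where "m t = max 0 (F t) + (\<Sum>j\<in>J. max 0 (- h j t))" for t
  have mpos: "0 < m t" if t: "t \<in> Q" for t
  proof (cases "\<forall>j\<in>J. 0 \<le> h j t")
    case True
    then show ?thesis using pos[OF t] unfolding m_def by (intro add_pos_nonneg sum_nonneg) auto
  next
    case False
    then obtain j where "j \<in> J" "h j t < 0" by force
    then have "0 < (\<Sum>j\<in>J. max 0 (- h j t))" using J by (intro sum_pos2) auto
    then show ?thesis unfolding m_def by (intro add_nonneg_pos) auto
  qed
  have "continuous_on Q m" unfolding m_def by (intro continuous_intros F h)
  then obtain t0 where t0: "t0 \<in> Q" "\<And>t. t \<in> Q \<Longrightarrow> m t0 \<le> m t"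
    using continuous_attains_inf[OF Q False] by blast
  obtain B where B: "\<And>t. t \<in> Q \<Longrightarrow> \<bar>F t\<bar> \<le> B"
    using compact_imp_bounded[OF compact_continuous_image[OF F Q]] unfolding bounded_iff by auto
  have B0: "0 \<le> B" using B[OF t0(1)] by linarith
  define r where "r = real (card J)"
  \<comment> \<open>\<open>m\<close> is a sum of \<open>r + 1\<close> nonnegative terms, so one of
    them reaches \<open>\<tau>\<close>.\<close>
  define \<tau> where "\<tau> = m t0 / (r + 1)"
  have \<tau>: "0 < \<tau>" using mpos[OF t0(1)] by (auto simp: \<tau>_def r_def intro!: divide_pos_pos)
  have dich: "\<tau> \<le> F t \<or> (\<exists>j\<in>J. \<tau> \<le> - h j t)" if t: "t \<in> Q" for t
  proof (rule ccontr)
    assume *: "\<not> ?thesis"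
    have "(\<Sum>j\<in>J. max 0 (- h j t)) \<le> (\<Sum>j\<in>J. \<tau>)"
      using * \<tau> by (intro sum_mono) force
    then have "(\<Sum>j\<in>J. max 0 (- h j t)) \<le> r * \<tau>" by (simp add: r_def)
    moreover have "max 0 (F t) < \<tau>" using * \<tau> by auto
    ultimately have "m t < \<tau> + r * \<tau>" unfolding m_def by linarith
    also have "\<dots> = \<tau> * (r + 1)" by (simp add: algebra_simps)
    also have "\<dots> = m t0"
    proof -
      have "0 < r + 1" by (simp add: r_def add_nonneg_pos)
      then show ?thesis by (simp add: \<tau>_def)
    qed
    finally show False using t0(2)[OF t] by simp
  qed
  \<comment> \<open>With \<open>c * \<tau> = B + \<tau>\<close>, one constraint violated by
    \<open>\<tau>\<close> outweighs the lowest possible value \<open>- B\<close> of \<open>F\<close>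
    with \<open>\<tau>\<close> to spare; \<open>k\<close> then keeps the loss from all other
    constraints below \<open>\<tau>\<close>.\<close>
  define c where "c = (B + \<tau>) / \<tau>"
  have c: "0 \<le> c" "c * \<tau> = B + \<tau>" using B0 \<tau> by (auto simp: c_def)
  obtain k0 :: nat where k0: "c * r / \<tau> < real k0" using reals_Archimedean2 by blast
  define k where "k = Suc k0"
  have k: "0 < k" "c * (r * (1 / real (2 * k))) < \<tau>"
  proof -
    have "c * r / \<tau> < real (2 * k)" using k0 by (simp add: k_def)
    then show "c * (r * (1 / real (2 * k))) < \<tau>" using \<tau> by (simp add: k_def field_simps)
  qed (simp add: k_def)
  have le: "(1 - h j t) ^ (2 * k) * h j t \<le> 1 / real (2 * k)" if "j \<in> J" "t \<in> Q" for j t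
    using that k(1) by (intro mult_one_minus_power_le h1) auto
  show thesis
  proof (rule that[OF c(1), of k])
    fix t assume t: "t \<in> Q"
    define \<Sigma> where "\<Sigma> = (\<Sum>j\<in>J. (1 - h j t) ^ (2 * k) * h j t)"
    from dich[OF t] show "0 < F t - c * (\<Sum>j\<in>J. (1 - h j t) ^ (2 * k) * h j t)"
    proof
      assume "\<tau> \<le> F t"
      have "\<Sigma> \<le> (\<Sum>j\<in>J. 1 / real (2 * k))" unfolding \<Sigma>_def by (intro sum_mono le t)
      then have "c * \<Sigma> \<le> c * (r * (1 / real (2 * k)))" by (intro mult_left_mono c(1)) (simp add: r_def)
      then show ?thesis using k(2) \<open>\<tau> \<le> F t\<close> by (simp add: \<Sigma>_def)
    next
      assume "\<exists>j\<in>J. \<tau> \<le> - h j t"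
      then obtain j where j: "j \<in> J" "\<tau> \<le> - h j t" by blast
      have "1 * (- h j t) \<le> (1 - h j t) ^ (2 * k) * (- h j t)"
        using j \<tau> by (intro mult_right_mono one_le_power) auto
      then have "(1 - h j t) ^ (2 * k) * h j t \<le> - \<tau>" using j(2) by simp
      moreover have "(\<Sum>j\<in>J - {j}. (1 - h j t) ^ (2 * k) * h j t) \<le> (\<Sum>j\<in>J - {j}. 1 / real (2 * k))"
        by (intro sum_mono le t) auto
      moreover have "\<dots> \<le> r * (1 / real (2 * k))"
        using J by (simp add: r_def divide_right_mono card_Diff1_le)
      ultimately have "\<Sigma> \<le> - \<tau> + r * (1 / real (2 * k))"
        unfolding \<Sigma>_def using sum.remove[OF J j(1), of "\<lambda>j. (1 - h j t) ^ (2 * k) * h j t"] by linarith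
      then have "c * \<Sigma> \<le> c * (- \<tau> + r * (1 / real (2 * k)))" by (intro mult_left_mono c(1))
      also have "\<dots> = - (B + \<tau>) + c * (r * (1 / real (2 * k)))" using c(2) by (simp add: algebra_simps)
      finally show ?thesis using k(2) B[OF t] by (simp add: \<Sigma>_def)
    qed
  qed
qed

section \<open>A Positivstellensatz with denominators\<close>

lemma mdeg_le_bound: "\<exists>N. \<forall>s\<in>Poly_Mapping.keys f. mdeg s \<le> N"
  by (rule exI[of _ "Max (mdeg ` Poly_Mapping.keys f)"]) simp

definition sq_chart :: "real ^ 'n::finite \<Rightarrow> real" where
  "sq_chart x = 1 + (\<Sum>i\<in>UNIV. (x $ i)\<^sup>2)"

lemma eval_sq_norm_poly [simp]: "eval sq_norm_poly x = sq_chart x - 1"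
  by (simp add: sq_norm_poly_def sq_chart_def)

lemma eval_one_plus_sq [simp]: "eval one_plus_sq x = sq_chart x"
  by (simp add: one_plus_sq_def)

lemma sq_chart_ge_1: "1 \<le> sq_chart x"
  by (simp add: sq_chart_def sum_nonneg)

lemma sq_chart_pos: "0 < sq_chart x"
  using sq_chart_ge_1[of x] by linarith

lemma sq_chart_neq_0 [simp]: "sq_chart x \<noteq> 0"
  using sq_chart_pos[of x] by simp

text \<open>The chart is inverse stereographic projection: its image is the sphere
  \<open>t\<^sub>0\<^sup>2 + \<Sum>\<^sub>i (t\<^sub>i - 1/2)\<^sup>2 = t\<^sub>0\<close> without the point at infinity \<open>t\<^sub>0 = 0\<close>.\<close>

definition chart :: "real ^ 'n::finite \<Rightarrow> real ^ 'n option" where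
  "chart x = (\<chi> j. case j of None \<Rightarrow> 1 / sq_chart x | Some i \<Rightarrow> 1 / 2 + x $ i / sq_chart x)"

definition sphere_eq :: "real ^ ('n::finite) option \<Rightarrow> real" where
  "sphere_eq t = (t $ None)\<^sup>2 + (\<Sum>i\<in>UNIV. (t $ Some i - 1 / 2)\<^sup>2) - t $ None"

text \<open>The homogenizing variable is \<open>t $ None\<close>. The coordinates are shifted by 1/2
  because \<open>x $ i / sq_chart x\<close> lies between -1/2 and 1/2, so that the chart maps into
  the unit cube.\<close>

definition homogenization :: "nat \<Rightarrow> 'n::finite mpol \<Rightarrow> real ^ 'n option \<Rightarrow> real" where
  "homogenization N f t = (\<Sum>s\<in>Poly_Mapping.keys f. Poly_Mapping.lookup f s *
     (\<Prod>i\<in>UNIV. (t $ Some i - 1 / 2) ^ Poly_Mapping.lookup s i) * (t $ None) ^ (N - mdeg s))"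

lemma chart_None [simp]: "chart x $ None = 1 / sq_chart x"
  by (simp add: chart_def)

lemma chart_Some [simp]: "chart x $ Some i = 1 / 2 + x $ i / sq_chart x"
  by (simp add: chart_def)

lemma sphere_eq_chart [simp]: "sphere_eq (chart x) = 0"
proof -
  have "(\<Sum>i\<in>UNIV. (x $ i)\<^sup>2) = sq_chart x - 1" by (simp add: sq_chart_def)
  then show ?thesis using sq_chart_pos[of x]
    by (simp add: sphere_eq_def power_divide sum_divide_distrib[symmetric] power2_eq_square field_simps)
qed

lemma chart_surj:
  assumes "sphere_eq t = 0" "t $ None > 0"
  obtains x where "t = chart x"
proof
  define x where "x = (\<chi> i. (t $ Some i - 1 / 2) / t $ None)"
  have "(\<Sum>i\<in>UNIV. (t $ Some i - 1 / 2)\<^sup>2) = t $ None - (t $ None)\<^sup>2"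
    using assms(1) by (simp add: sphere_eq_def)
  then have "sq_chart x = 1 / t $ None"
    using assms(2) by (simp add: sq_chart_def x_def power_divide sum_divide_distrib[symmetric]
        power2_eq_square field_simps)
  then show "t = chart x"
    using assms(2) by (auto simp: vec_eq_iff chart_def x_def split: option.split)
qed

lemma homogenization_chart:
  assumes "\<And>s. s \<in> Poly_Mapping.keys f \<Longrightarrow> mdeg s \<le> N"
  shows "homogenization N f (chart x) = eval f x / sq_chart x ^ N"
proof -
  have "(\<Prod>i\<in>UNIV. (x $ i / sq_chart x) ^ Poly_Mapping.lookup s i) * (1 / sq_chart x) ^ (N - mdeg s)
      = mono_eval x s / sq_chart x ^ N" if "s \<in> Poly_Mapping.keys f" for s
  proof -
    have "(\<Prod>i\<in>UNIV. (x $ i / sq_chart x) ^ Poly_Mapping.lookup s i)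
        = mono_eval x s / (\<Prod>i\<in>UNIV. sq_chart x ^ Poly_Mapping.lookup s i)"
      by (simp add: mono_eval_def power_divide prod_dividef)
    also have "(\<Prod>i\<in>UNIV. sq_chart x ^ Poly_Mapping.lookup s i) = sq_chart x ^ mdeg s"
      by (simp add: mdeg_def power_sum)
    finally have "(\<Prod>i\<in>UNIV. (x $ i / sq_chart x) ^ Poly_Mapping.lookup s i) * (1 / sq_chart x) ^ (N - mdeg s)
        = mono_eval x s / (sq_chart x ^ mdeg s * sq_chart x ^ (N - mdeg s))"
      by (simp add: power_divide)
    then show ?thesis using assms[OF that] by (simp add: power_add[symmetric])
  qed
  then show ?thesis
    by (simp add: homogenization_def eval_superset[OF finite_keys order_refl] sum_divide_distrib mult.assoc)
qed

text \<open>The strict degree bound leaves a positive power of \<open>t $ None\<close> in every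
  term. At the point at infinity only the perturbation of \<open>f\<close> survives.\<close>

lemma homogenization_infinity:
  assumes "\<And>s. s \<in> Poly_Mapping.keys f \<Longrightarrow> mdeg s < N" "t $ None = 0"
  shows "homogenization N f t = 0"
  unfolding homogenization_def by (intro sum.neutral ballI) (use assms in auto)

lemma homogenization_is_eval: "\<exists>p. homogenization N f = eval p"
proof
  show "homogenization N f = eval (\<Sum>s\<in>Poly_Mapping.keys f. cst (Poly_Mapping.lookup f s) *
     (\<Prod>i\<in>UNIV. (var (Some i) - cst (1 / 2)) ^ Poly_Mapping.lookup s i) * var None ^ (N - mdeg s))"
    by (simp add: fun_eq_iff homogenization_def)
qed

lemma sphere_eq_is_eval: "\<exists>p. sphere_eq = eval p"
proof
  show "sphere_eq = eval (var None ^ 2 + (\<Sum>i\<in>UNIV. (var (Some i) - cst (1 / 2)) ^ 2) - var None)"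
    by (simp add: fun_eq_iff sphere_eq_def)
qed

text \<open>\<open>rational_in M u\<close>: the function \<open>u\<close> lies in the module generated by \<open>M\<close> in the localization
  at \<open>1 + \<bar>X\<bar>\<^sup>2\<close>. The exponent is even, so that denominators can be changed within \<open>M\<close>.\<close>

definition rational_in :: "'n::finite mpol set \<Rightarrow> (real ^ 'n \<Rightarrow> real) \<Rightarrow> bool" where
  "rational_in M u \<longleftrightarrow> (\<exists>m. \<exists>q\<in>M. \<forall>x. u x * sq_chart x ^ (2 * m) = eval q x)"

text \<open>An odd exponent is made even by multiplying with \<open>one_plus_sq ^ k\<close>, a sum
  of squares.\<close>

lemma rational_inI:
  assumes M: "is_quadratic_module M" and q: "q \<in> M" "\<And>x. u x * sq_chart x ^ k = eval q x"
  shows "rational_in M u"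
  unfolding rational_in_def
proof (intro exI bexI allI)
  show "one_plus_sq ^ k * q \<in> M" using M q(1) by (intro quadratic_module_mult sos_power) auto
  show "u x * sq_chart x ^ (2 * k) = eval (one_plus_sq ^ k * q) x" for x
    by (simp add: q(2)[symmetric] mult_2 power_add)
qed

lemma rational_in_mono: "rational_in M u \<Longrightarrow> M \<subseteq> M' \<Longrightarrow> rational_in M' u"
  unfolding rational_in_def by blast

lemma rational_in_add:
  assumes M: "is_quadratic_module M" and "rational_in M u" "rational_in M v"
  shows "rational_in M (\<lambda>x. u x + v x)"
proof -
  obtain m p where p: "p \<in> M" "\<And>x. u x * sq_chart x ^ (2 * m) = eval p x"
    using assms(2) unfolding rational_in_def by blast
  obtain k q where q: "q \<in> M" "\<And>x. v x * sq_chart x ^ (2 * k) = eval q x"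
    using assms(3) unfolding rational_in_def by blast
  show ?thesis
  proof (rule rational_inI[OF M])
    show "one_plus_sq ^ (2 * k) * p + one_plus_sq ^ (2 * m) * q \<in> M"
      using M p q by (intro quadratic_module_add quadratic_module_mult sos_power) auto
    show "(u x + v x) * sq_chart x ^ (2 * m + 2 * k)
        = eval (one_plus_sq ^ (2 * k) * p + one_plus_sq ^ (2 * m) * q) x" for x
      by (simp add: p(2)[symmetric] q(2)[symmetric] power_add algebra_simps)
  qed
qed

lemma rational_in_mult:
  assumes M: "is_quadratic_module M" and "rational_in sos u" "rational_in M v"
  shows "rational_in M (\<lambda>x. u x * v x)"
proof -
  obtain m p where p: "p \<in> sos" "\<And>x. u x * sq_chart x ^ (2 * m) = eval p x"
    using assms(2) unfolding rational_in_def by blast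
  obtain k q where q: "q \<in> M" "\<And>x. v x * sq_chart x ^ (2 * k) = eval q x"
    using assms(3) unfolding rational_in_def by blast
  show ?thesis
  proof (rule rational_inI[OF M])
    show "p * q \<in> M" using M p q by (intro quadratic_module_mult)
    show "(u x * v x) * sq_chart x ^ (2 * m + 2 * k) = eval (p * q) x" for x
      by (simp add: p(2)[symmetric] q(2)[symmetric] power_add mult_ac)
  qed
qed

lemma rational_in_const:
  assumes "0 \<le> c"
  shows "rational_in sos (\<lambda>_. c)"
  using assms by (intro rational_inI[OF is_quadratic_module_sos, of "cst c" _ 0]) auto

lemma rational_in_power:
  assumes "rational_in sos u"
  shows "rational_in sos (\<lambda>x. u x ^ k)"
proof (induction k)
  case 0
  then show ?case using rational_in_const[of 1] by simp
next
  case (Suc k)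
  then show ?case using rational_in_mult[OF is_quadratic_module_sos assms Suc.IH] by simp
qed

lemma rational_in_sum:
  assumes M: "is_quadratic_module M" and "\<And>a. a \<in> A \<Longrightarrow> rational_in M (F a)"
  shows "rational_in M (\<lambda>x. \<Sum>a\<in>A. F a x)"
  using assms(2)
proof (induction A rule: infinite_finite_induct)
  case (insert a A)
  then show ?case by (auto intro: rational_in_add[OF M])
qed (use rational_in_mono[OF rational_in_const[of 0] sos_subset_quadratic_module[OF M]] in auto)

text \<open>Completing the square in the variable \<open>i\<close> leaves the squares of the other
  variables. These are the numerators of \<open>t $ Some i\<close> and \<open>1 - t $ Some i\<close>
  on the chart.\<close>

lemma one_plus_sq_pm_var_sos:
  fixes i :: "'n::finite"
  assumes "\<bar>c\<bar> = 1"
  shows "one_plus_sq + cst (2 * c) * var i \<in> sos"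
proof -
  have "c\<^sup>2 = 1" using assms by (metis abs_1 power2_abs one_power2)
  have "one_plus_sq + cst (2 * c) * var i = (1 + cst c * var i)\<^sup>2 + (\<Sum>j\<in>UNIV - {i}. (var j)\<^sup>2)"
  proof (rule eval_inject)
    fix x :: "real ^ 'n"
    have "(\<Sum>j\<in>UNIV. (x $ j)\<^sup>2) = (x $ i)\<^sup>2 + (\<Sum>j\<in>UNIV - {i}. (x $ j)\<^sup>2)"
      by (rule sum.remove) auto
    then show "eval (one_plus_sq + cst (2 * c) * var i) x
        = eval ((1 + cst c * var i)\<^sup>2 + (\<Sum>j\<in>UNIV - {i}. (var j)\<^sup>2)) x"
      using \<open>c\<^sup>2 = 1\<close> by (simp add: sq_chart_def power2_sum power_mult_distrib)
  qed
  also have "\<dots> \<in> sos" by (intro sos_add sos_sum) auto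
  finally show ?thesis .
qed

lemma handelman_chart:
  fixes F :: "real ^ ('n::finite) option \<Rightarrow> real"
  assumes "handelman F"
  shows "rational_in sos (\<lambda>x. F (chart x))"
  using assms
proof induction
  case (const c)
  then show ?case by (rule rational_in_const)
next
  case (coord j)
  show ?case
  proof (cases j)
    case None
    show ?thesis unfolding None
      by (rule rational_inI[OF is_quadratic_module_sos, of 1 _ 1])
        (auto simp: power2_eq_square)
  next
    case (Some i)
    show ?thesis unfolding Some
    proof (rule rational_inI[OF is_quadratic_module_sos, where k = 1])
      show "cst (1 / 2) * (one_plus_sq + cst (2 * 1) * var i) \<in> sos"
        by (intro sos_cst_mult one_plus_sq_pm_var_sos) auto
    qed (simp add: field_simps)
  qed
next
  case (compl j)
  show ?case
  proof (cases j)
    case None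
    show ?thesis unfolding None
      by (rule rational_inI[OF is_quadratic_module_sos, of sq_norm_poly _ 1])
        (auto simp: field_simps power2_eq_square)
  next
    case (Some i)
    show ?thesis unfolding Some
    proof (rule rational_inI[OF is_quadratic_module_sos, where k = 1])
      show "cst (1 / 2) * (one_plus_sq + cst (2 * (- 1)) * var i) \<in> sos"
        by (intro sos_cst_mult one_plus_sq_pm_var_sos) auto
    qed (simp add: field_simps)
  qed
next
  case (add F G)
  then show ?case by (intro rational_in_add is_quadratic_module_sos)
next
  case (mult F G)
  then show ?case by (intro rational_in_mult is_quadratic_module_sos)
qed

lemma positivstellensatz:
  fixes S :: "'n::finite mpol set"
  assumes S: "finite S" and f: "f \<in> Psd (nonneg_set S)" and "0 < \<epsilon>"
    and N: "\<And>s. s \<in> Poly_Mapping.keys f \<Longrightarrow> mdeg s < N"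
  obtains m where "one_plus_sq ^ (2 * m) * (f + cst \<epsilon> * one_plus_sq ^ N) \<in> gen_quadratic_module S"
proof -
  define M where "M = gen_quadratic_module S"
  have M: "is_quadratic_module M" unfolding M_def by (rule is_quadratic_module_gen)
  define Q where "Q = cbox 0 (1 :: real ^ 'n option)"
  have Q: "compact Q" by (simp add: Q_def)
  define n :: "'n mpol \<Rightarrow> nat" where "n g = (SOME N. \<forall>s\<in>Poly_Mapping.keys g. mdeg s \<le> N)" for g
  have n: "mdeg s \<le> n g" if "s \<in> Poly_Mapping.keys g" for g s
    using someI_ex[OF mdeg_le_bound[of g]] that unfolding n_def by blast
  have cont_hom: "continuous_on A (homogenization k g)" for A k and g :: "'n mpol"
    using homogenization_is_eval[of k g] continuous_on_eval by metis
  \<comment> \<open>Normalizes the constraints to be at most 1 on the cube, as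
    \<open>constraint_removal\<close> demands.\<close>
  have "\<exists>C>0. \<forall>t\<in>Q. homogenization (n g) g t \<le> C" for g
  proof -
    obtain C where "\<And>t. t \<in> Q \<Longrightarrow> \<bar>homogenization (n g) g t\<bar> \<le> C"
      using compact_imp_bounded[OF compact_continuous_image[OF cont_hom Q]]
      unfolding bounded_iff by (metis imageI real_norm_def)
    then show ?thesis by (intro exI[of _ "\<bar>C\<bar> + 1"]) force
  qed
  then obtain C where C: "\<And>g. 0 < C g" "\<And>g t. t \<in> Q \<Longrightarrow> homogenization (n g) g t \<le> C g"
    by metis
  \<comment> \<open>The sphere equation becomes the inequality
    \<open>- sphere_eq\<^sup>2 \<ge> 0\<close>. It holds with value 0 on the chart, so its term
    disappears on pulling back.\<close>
  define h where "h j t = (case j of None \<Rightarrow> - (sphere_eq t)\<^sup>2 | Some g \<Rightarrow> homogenization (n g) g t / C g)" for j t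
  define J where "J = insert None (Some ` S)"
  define F where "F t = \<epsilon> + homogenization N f t" for t
  have J: "finite J" using S by (simp add: J_def)
  have F_eval: "\<exists>p. F = eval p"
  proof -
    obtain p where "homogenization N f = eval p" using homogenization_is_eval by blast
    then have "F = eval (cst \<epsilon> + p)" by (simp add: fun_eq_iff F_def)
    then show ?thesis by blast
  qed
  have h_eval: "\<exists>p. h j = eval p" for j
  proof (cases j)
    case None
    obtain p where "sphere_eq = (eval p :: real ^ 'n option \<Rightarrow> real)" using sphere_eq_is_eval by blast
    then have "h j = eval (- (p ^ 2))" by (simp add: fun_eq_iff h_def None)
    then show ?thesis by blast
  next
    case (Some g)
    obtain p where "homogenization (n g) g = eval p" using homogenization_is_eval by blast
    then have "h j = eval (cst (1 / C g) * p)" by (simp add: fun_eq_iff h_def Some)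
    then show ?thesis by blast
  qed
  \<comment> \<open>The feasible points of the cube are those on the chart over
    \<open>nonneg_set S\<close>, where \<open>f\<close> is nonnegative, and possibly the point at
    infinity, where \<open>F\<close> equals \<open>\<epsilon>\<close>.\<close>
  have pos: "0 < F t" if t: "t \<in> Q" and ht: "\<forall>j\<in>J. 0 \<le> h j t" for t
  proof -
    have "0 \<le> h None t" using ht by (simp add: J_def)
    then have sph: "sphere_eq t = 0" by (simp add: h_def)
    have t0: "0 \<le> t $ None" using t by (simp add: Q_def mem_box_cart)
    show ?thesis
    proof (cases "t $ None = 0")
      case True
      then show ?thesis using homogenization_infinity[OF N True] \<open>0 < \<epsilon>\<close> by (simp add: F_def)
    next
      case False
      then obtain x where x: "t = chart x" using chart_surj[OF sph] t0 by force
      have "0 \<le> eval g x" if "g \<in> S" for g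
      proof -
        have "0 \<le> h (Some g) t" using ht that by (simp add: J_def)
        then have "0 \<le> eval g x / (sq_chart x ^ n g * C g)"
          by (simp add: h_def x homogenization_chart[OF n])
        moreover have "0 < sq_chart x ^ n g * C g"
          by (intro mult_pos_pos zero_less_power C(1) sq_chart_pos)
        ultimately show ?thesis by (auto simp: zero_le_divide_iff)
      qed
      then have "0 \<le> eval f x" using f by (auto simp: Psd_def nonneg_set_def)
      then have "0 \<le> homogenization N f t"
        using sq_chart_pos[of x] by (simp add: x homogenization_chart[OF less_imp_le[OF N]])
      then show ?thesis using \<open>0 < \<epsilon>\<close> by (simp add: F_def)
    qed
  qed
  have cF: "continuous_on Q F" using F_eval continuous_on_eval by metis
  have ch: "continuous_on Q (h j)" for j using h_eval continuous_on_eval by metis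
  have h1: "h j t \<le> 1" if "t \<in> Q" for j t
  proof (cases j)
    case None
    have "h j t \<le> 0" by (simp add: h_def None)
    then show ?thesis by simp
  next
    case (Some g)
    then show ?thesis using C(2)[OF that, of g] C(1)[of g] by (simp add: h_def)
  qed
  obtain c k where c: "0 \<le> c"
    and Epos: "\<And>t. t \<in> Q \<Longrightarrow> 0 < F t - c * (\<Sum>j\<in>J. (1 - h j t) ^ (2 * k) * h j t)"
    by (rule constraint_removal[OF Q J cF ch h1 pos]) auto
  define E where "E t = F t - c * (\<Sum>j\<in>J. (1 - h j t) ^ (2 * k) * h j t)" for t
  obtain pF where pF: "F = eval pF" using F_eval by blast
  obtain ph where ph: "\<And>j. h j = eval (ph j)" using h_eval by metis
  have E: "E = eval (pF - cst c * (\<Sum>j\<in>J. (1 - ph j) ^ (2 * k) * ph j))"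
    by (simp add: fun_eq_iff E_def pF ph)
  have "handelman E" unfolding E
    by (rule handelman_if_pos_on_cube) (use Epos in \<open>simp add: E[symmetric] E_def Q_def\<close>)
  then have "rational_in sos (\<lambda>x. E (chart x))" by (rule handelman_chart)
  then have E_in: "rational_in M (\<lambda>x. E (chart x))"
    by (rule rational_in_mono) (rule sos_subset_quadratic_module[OF M])
  have hj: "rational_in M (\<lambda>x. (1 - h j (chart x)) ^ (2 * k) * h j (chart x))" if "j \<in> J" for j
  proof (cases j)
    case None
    then show ?thesis
      using rational_in_mono[OF rational_in_const[of 0] sos_subset_quadratic_module[OF M]]
      by (simp add: h_def)
  next
    case (Some g)
    with that have g: "g \<in> M" by (auto simp: J_def M_def intro: gen_quadratic_module_inc)
    have hg: "h j (chart x) = eval g x / sq_chart x ^ n g / C g" for x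
      by (simp add: h_def Some homogenization_chart[OF n])
    have "rational_in sos (\<lambda>x. (1 - h j (chart x))\<^sup>2)"
    proof (rule rational_inI[OF is_quadratic_module_sos])
      show "(one_plus_sq ^ n g - cst (1 / C g) * g)\<^sup>2 \<in> sos" by simp
      show "(1 - h j (chart x))\<^sup>2 * sq_chart x ^ (2 * n g)
          = eval ((one_plus_sq ^ n g - cst (1 / C g) * g)\<^sup>2) x" for x
      proof -
        have "(1 - h j (chart x)) * sq_chart x ^ n g = sq_chart x ^ n g - eval g x / C g"
          using sq_chart_pos[of x] by (simp add: hg field_simps)
        then have "((1 - h j (chart x)) * sq_chart x ^ n g)\<^sup>2 = (sq_chart x ^ n g - eval g x / C g)\<^sup>2"
          by simp
        then show ?thesis by (simp add: power_mult_distrib mult.commute flip: power_mult)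
      qed
    qed
    then have 1: "rational_in sos (\<lambda>x. (1 - h j (chart x)) ^ (2 * k))"
      using rational_in_power[of "\<lambda>x. (1 - h j (chart x))\<^sup>2" k] by (simp add: power_mult)
    have 2: "rational_in M (\<lambda>x. h j (chart x))"
    proof (rule rational_inI[OF M])
      show "cst (1 / C g) * g \<in> M" using C(1)[of g] by (intro quadratic_module_mult[OF M _ g]) auto
      show "h j (chart x) * sq_chart x ^ n g = eval (cst (1 / C g) * g) x" for x
        using sq_chart_pos[of x] by (simp add: hg)
    qed
    show ?thesis by (rule rational_in_mult[OF M 1 2])
  qed
  \<comment> \<open>On the chart the constraint terms that were subtracted lie in the localized
    module, so they may be added back.\<close>
  have "rational_in M (\<lambda>x. E (chart x) + c * (\<Sum>j\<in>J. (1 - h j (chart x)) ^ (2 * k) * h j (chart x)))"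
    by (intro rational_in_add rational_in_mult rational_in_sum rational_in_const M E_in hj c)
  then have "rational_in M (\<lambda>x. F (chart x))" by (simp add: E_def)
  then obtain m q where q: "q \<in> M" "\<And>x. F (chart x) * sq_chart x ^ (2 * m) = eval q x"
    unfolding rational_in_def by blast
  have "one_plus_sq ^ (2 * m) * (f + cst \<epsilon> * one_plus_sq ^ N) = one_plus_sq ^ N * q"
  proof (rule eval_inject)
    fix x
    have "F (chart x) * sq_chart x ^ N = eval f x + \<epsilon> * sq_chart x ^ N"
      using sq_chart_pos[of x] homogenization_chart[of f N x, OF less_imp_le[OF N]]
      by (simp add: F_def field_simps)
    then have "eval (one_plus_sq ^ (2 * m) * (f + cst \<epsilon> * one_plus_sq ^ N)) x
        = sq_chart x ^ N * (F (chart x) * sq_chart x ^ (2 * m))"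
      by (simp add: mult.commute)
    then show "eval (one_plus_sq ^ (2 * m) * (f + cst \<epsilon> * one_plus_sq ^ N)) x = eval (one_plus_sq ^ N * q) x"
      by (simp only: q(2)) simp
  qed
  moreover have "one_plus_sq ^ N * q \<in> M" using q(1) by (intro quadratic_module_mult[OF M]) auto
  ultimately have "one_plus_sq ^ (2 * m) * (f + cst \<epsilon> * one_plus_sq ^ N) \<in> gen_quadratic_module S"
    by (simp add: M_def)
  then show thesis by (rule that)
qed

section \<open>The closure of the quadratic module\<close>

text \<open>The perturbations tend to \<open>g\<close> in norm as \<open>\<eta>\<close> tends to 0.
  Used to remove both the perturbation of \<open>f\<close> and the square that absorbs the error of
  cancelling a denominator.\<close>

lemma w_closure_transfer:
  fixes g h :: "'n::finite mpol"
  assumes "\<And>\<eta>. 0 < \<eta> \<Longrightarrow> g + cst \<eta> * h \<in> w_topology closure_of M"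
  shows "g \<in> w_topology closure_of M"
proof (rule in_w_closureI)
  fix e :: real assume "0 < e"
  define \<eta> where "\<eta> = e / (2 * (w_norm h + 1))"
  have h: "0 \<le> w_norm h" by (rule w_norm_nonneg)
  have \<eta>: "0 < \<eta>" using \<open>0 < e\<close> h by (simp add: \<eta>_def)
  have "g + cst \<eta> * h \<in> w_topology closure_of M" by (rule assms[OF \<eta>])
  then obtain a where a: "a \<in> M" "w_norm (a - (g + cst \<eta> * h)) < e / 2"
    using in_w_closureD[of _ M "e / 2"] \<open>0 < e\<close> by auto
  have "w_norm (cst \<eta> * h) = \<eta> * w_norm h" using \<eta> by (simp add: w_norm_cst_times)
  also have "\<dots> \<le> \<eta> * (w_norm h + 1)" using \<eta> by (intro mult_left_mono) auto
  also have "\<dots> = e / 2" using h by (simp add: \<eta>_def field_simps)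
  finally have "w_norm (a - g) < e"
    using w_norm_add[of "a - (g + cst \<eta> * h)" "cst \<eta> * h"] a(2) by (simp add: algebra_simps)
  then show "\<exists>a\<in>M. w_norm (a - g) < e" using a(1) by blast
qed

text \<open>Choose \<open>u\<close> with \<open>r = 1 - (1 + \<bar>X\<bar>\<^sup>2)\<^sup>m u\<close> small. Then \<open>(1 - r)\<^sup>2 F \<in> M\<close>, and the error \<open>2rF - r\<^sup>2F\<close> is
  absorbed by \<open>\<eta>F\<^sup>2 + (1/\<eta> + (1 + F\<^sup>2)/2) r\<^sup>2\<close>.\<close>

lemma w_closure_cancel_denominator:
  fixes M :: "'n::finite mpol set"
  assumes M: "is_quadratic_module M" and F: "one_plus_sq ^ (2 * m) * F \<in> M"
  shows "F \<in> w_topology closure_of M"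
proof (rule w_closure_transfer[of _ "F\<^sup>2"], rule in_w_closureI)
  fix \<eta> e :: real assume \<eta>: "0 < \<eta>" and "0 < e"
  \<comment> \<open>The term \<open>1 / \<eta>\<close> completes the square in \<open>sq\<close>.
    The other one comes from \<open>- r\<^sup>2 * F = (r * (1 - F))\<^sup>2 / 2 - (1 + F\<^sup>2) *
    r\<^sup>2 / 2\<close>.\<close>
  define H where "H = cst (1 / \<eta>) + cst (1 / 2) * (1 + F\<^sup>2)"
  have "H \<in> sos" unfolding H_def using \<eta> by (intro sos_add sos_cst sos_cst_mult) auto
  from density_one_plus_sq_power[OF this \<open>0 < e\<close>, of 1 m] obtain u \<epsilon> where
    u: "w_norm \<epsilon> < e" "\<epsilon> - H * (1 - one_plus_sq ^ m * u)\<^sup>2 \<in> sos" by blast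
  define r where "r = 1 - one_plus_sq ^ m * u"
  have 1: "(1 - r)\<^sup>2 * F \<in> M"
  proof -
    have "(1 - r)\<^sup>2 * F = u\<^sup>2 * (one_plus_sq ^ (2 * m) * F)"
      by (simp add: r_def power_mult_distrib power_mult[symmetric] mult_ac)
    then show ?thesis using quadratic_module_mult[OF M sos_square F] by metis
  qed
  have sq: "cst \<eta> * F\<^sup>2 + cst 2 * (r * F) + cst (1 / \<eta>) * r\<^sup>2 = (cst (sqrt \<eta>) * F + cst (1 / sqrt \<eta>) * r)\<^sup>2"
  proof (rule eval_inject)
    fix x
    have "(sqrt \<eta> * eval F x + 1 / sqrt \<eta> * eval r x)\<^sup>2
        = (sqrt \<eta>)\<^sup>2 * (eval F x)\<^sup>2 + 2 * (sqrt \<eta> * (1 / sqrt \<eta>)) * (eval r x * eval F x) + (1 / sqrt \<eta>)\<^sup>2 * (eval r x)\<^sup>2"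
      by (simp only: power2_sum power_mult_distrib) (simp only: mult_ac)
    then show "eval (cst \<eta> * F\<^sup>2 + cst 2 * (r * F) + cst (1 / \<eta>) * r\<^sup>2) x
        = eval ((cst (sqrt \<eta>) * F + cst (1 / sqrt \<eta>) * r)\<^sup>2) x"
      using \<eta> by (simp add: power_divide)
  qed
  have "F + cst \<eta> * F\<^sup>2 + \<epsilon> = (1 - r)\<^sup>2 * F
      + (cst \<eta> * F\<^sup>2 + cst 2 * (r * F) + cst (1 / \<eta>) * r\<^sup>2)
      + cst (1 / 2) * (r * (1 - F))\<^sup>2 + (\<epsilon> - H * r\<^sup>2)"
  proof (rule eval_inject)
    fix x
    show "eval (F + cst \<eta> * F\<^sup>2 + \<epsilon>) x = eval ((1 - r)\<^sup>2 * F
      + (cst \<eta> * F\<^sup>2 + cst 2 * (r * F) + cst (1 / \<eta>) * r\<^sup>2)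
      + cst (1 / 2) * (r * (1 - F))\<^sup>2 + (\<epsilon> - H * r\<^sup>2)) x"
      by (simp add: H_def power2_eq_square algebra_simps)
  qed
  also have "\<dots> \<in> M"
    unfolding sq
    by (intro quadratic_module_add[OF M] 1 subsetD[OF sos_subset_quadratic_module[OF M]]
        sos_square sos_cst_mult u(2)[folded r_def]) simp
  finally have "F + cst \<eta> * F\<^sup>2 + \<epsilon> \<in> M" .
  then show "\<exists>a\<in>M. w_norm (a - (F + cst \<eta> * F\<^sup>2)) < e"
    using u(1) by (intro bexI[of _ "F + cst \<eta> * F\<^sup>2 + \<epsilon>"]) auto
qed

lemma Psd_subset_w_closure:
  fixes S :: "'n::finite mpol set"
  assumes "finite S"
  shows "Psd (nonneg_set S) \<subseteq> w_topology closure_of gen_quadratic_module S"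
proof
  fix f assume f: "f \<in> Psd (nonneg_set S)"
  obtain N where N: "\<forall>s\<in>Poly_Mapping.keys f. mdeg s \<le> N" using mdeg_le_bound by blast
  show "f \<in> w_topology closure_of gen_quadratic_module S"
  \<comment> \<open>The successor provides the strict degree bound that
    \<open>positivstellensatz\<close> needs at infinity.\<close>
  proof (rule w_closure_transfer[of _ "one_plus_sq ^ Suc N"])
    fix \<epsilon> :: real assume "0 < \<epsilon>"
    obtain m where "one_plus_sq ^ (2 * m) * (f + cst \<epsilon> * one_plus_sq ^ Suc N) \<in> gen_quadratic_module S"
      by (rule positivstellensatz[OF assms f \<open>0 < \<epsilon>\<close>, of "Suc N"]) (use N in \<open>auto simp: less_Suc_eq_le\<close>)
    then show "f + cst \<epsilon> * one_plus_sq ^ Suc N \<in> w_topology closure_of gen_quadratic_module S"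
      by (rule w_closure_cancel_denominator[OF is_quadratic_module_gen])
  qed
qed

theorem proposition6p8:
  fixes S :: "'n::finite mpol set" and d :: nat
  assumes "finite S" and "d \<ge> 1"
  shows
    "(compact (nonneg_set S) \<longrightarrow>
        finer_topology (w_topology :: 'n mpol topology) (sup_topology (nonneg_set S)) \<and>
        w_topology closure_of gen_quadratic_module S = w_topology closure_of gen_preordering S \<and>
        w_topology closure_of gen_preordering S =
          sup_topology (nonneg_set S) closure_of sums_of_powers (2 * d) \<and>
        sup_topology (nonneg_set S) closure_of sums_of_powers (2 * d) = Psd (nonneg_set S)) \<and>
     (finer_topology (w_topology :: 'n mpol topology) (pt_topology (nonneg_set S)) \<and>
        w_topology closure_of gen_quadratic_module S = w_topology closure_of gen_preordering S \<and>
        w_topology closure_of gen_preordering S =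
          pt_topology (nonneg_set S) closure_of sums_of_powers (2 * d) \<and>
        pt_topology (nonneg_set S) closure_of sums_of_powers (2 * d) = Psd (nonneg_set S))"
proof -
  have M: "Psd (nonneg_set S) \<subseteq> w_topology closure_of gen_quadratic_module S"
    by (rule Psd_subset_w_closure[OF assms(1)])
  have MT: "w_topology closure_of gen_quadratic_module S \<subseteq> w_topology closure_of gen_preordering S"
    by (intro closure_of_mono gen_quadratic_module_subset_preordering)
  have T: "w_topology closure_of gen_preordering S \<subseteq> Psd (nonneg_set S)"
    by (intro w_closure_subset_Psd gen_preordering_subset_Psd)
  have "w_topology closure_of gen_quadratic_module S = Psd (nonneg_set S)"
    "w_topology closure_of gen_preordering S = Psd (nonneg_set S)"
    using M MT T by blast+
  then show ?thesis
    by (simp add: w_topology_finer_sup w_topology_finer_pt sup_closure_sums_of_even_powers[OF _ assms(2)]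
        pt_closure_sums_of_even_powers[OF assms(2)])
qed

end
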